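(* For every real constant $\epsilon>0$ the following holds for every sufficiently large integer $n$. Let $k$ be a positive integer with $k\le n^{1/4-\epsilon}$ and let $\xi>1$ be real. Fix a balanced $k$-partition $V_1\,\dot\cup\,\cdots\,\dot\cup\,V_k$ of the vertex set $V$, $|V|=n$. If $\mathbf{G}$ is sampled from the Erdős–Rényi distribution $\mathscr{G}(n,n^{-2\xi/(k-1)})$ on $V$, then with probability at least $1-\exp(-\sqrt{n})$, every regular resolution refutation of $\mathrm{Clique}_{\mathrm{block}}(\mathbf{G},k)$ has length at least $n^{\Omega(k/\xi^2)}$.
   Context: $\mathscr{G}(n,p)$ is the distribution on graphs on a fixed $n$-vertex set where each potential edge is included independently with probability $p$. A $k$-partition $V_1\dot\cup\cdots\dot\cup V_k=V$ is balanced if $|V_i|\le |V_j|+1$ for all $i,j$. For a graph $G=(V,E)$ with balanced $k$-partition, $\mathrm{Clique}_{\mathrm{block}}(G,k)$ is the CNF over variables $x_v$ ($v\in V$) with clauses: $\neg x_u\vee\neg x_v$ for all $u\ne v$ with $\{u,v\}\notin E$ (edge axioms); $\bigvee_{v\in V_i}x_v$ for each $i\in[k]$ (clique axioms); $\neg x_u\vee\neg x_v$ for each $i\in[k]$ and distinct $u,v\in V_i$ (functionality axioms). A resolution refutation is a sequence of clauses, each an initial clause or obtained from two earlier ones by the rule $B\vee x,\ C\vee\neg x\vdash B\vee C$, ending with the empty clause; its length is the number of clauses. It is regular if, viewing it as a DAG, no variable is resolved on more than once along any source-to-sink path. *)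

theory Defs
  imports "HOL-Probability.Probability"
begin

datatype 'v literal = Pos 'v | Neg 'v

type_synonym 'v clause = "'v literal set"
type_synonym 'v cnf = "'v clause set"

text \<open>
  A graph on the vertex set \<open>V\<close> is given by its edge set, a subset of the two-element
  subsets of \<open>V\<close>.
\<close>

definition pairs :: "'a set \<Rightarrow> 'a set set" where
  "pairs V = {e. e \<subseteq> V \<and> card e = 2}"

definition erdos_renyi :: "'a set \<Rightarrow> real \<Rightarrow> 'a set set pmf" where
  "erdos_renyi V p =
     map_pmf (\<lambda>f. {e \<in> pairs V. f e}) (Pi_pmf (pairs V) False (\<lambda>_. bernoulli_pmf p))"

definition balanced_partition :: "'a set \<Rightarrow> nat \<Rightarrow> (nat \<Rightarrow> 'a set) \<Rightarrow> bool" where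
  "balanced_partition V k W \<longleftrightarrow>
     (\<Union>i\<in>{1..k}. W i) = V \<and> disjoint_family_on W {1..k} \<and>
     (\<forall>i\<in>{1..k}. \<forall>j\<in>{1..k}. card (W i) \<le> card (W j) + 1)"

definition edge_axioms :: "'a set \<Rightarrow> 'a set set \<Rightarrow> 'a cnf" where
  "edge_axioms V E = {{Neg u, Neg v} | u v. u \<in> V \<and> v \<in> V \<and> u \<noteq> v \<and> {u, v} \<notin> E}"

definition clique_axioms :: "nat \<Rightarrow> (nat \<Rightarrow> 'a set) \<Rightarrow> 'a cnf" where
  "clique_axioms k W = {Pos ` W i | i. i \<in> {1..k}}"

definition functionality_axioms :: "nat \<Rightarrow> (nat \<Rightarrow> 'a set) \<Rightarrow> 'a cnf" where
  "functionality_axioms k W =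
     {{Neg u, Neg v} | i u v. i \<in> {1..k} \<and> u \<in> W i \<and> v \<in> W i \<and> u \<noteq> v}"

definition Clique_block :: "'a set \<Rightarrow> 'a set set \<Rightarrow> nat \<Rightarrow> (nat \<Rightarrow> 'a set) \<Rightarrow> 'a cnf" where
  "Clique_block V E k W = edge_axioms V E \<union> clique_axioms k W \<union> functionality_axioms k W"

text \<open>
  A derivation is a list of clauses, each with the inference that produced it, so that the
  underlying DAG on the positions of the list is determined. \<open>Resolve x i j\<close> resolves the
  clauses at positions \<open>i\<close> (containing \<open>x\<close> positively) and \<open>j\<close> (containing \<open>x\<close> negatively).
\<close>

datatype 'v inference = Initial | Resolve 'v nat nat

type_synonym 'v derivation = "('v clause \<times> 'v inference) list"

definition valid_step :: "'v cnf \<Rightarrow> 'v derivation \<Rightarrow> nat \<Rightarrow> bool" where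
  "valid_step F \<pi> m \<longleftrightarrow>
     (case snd (\<pi> ! m) of
        Initial \<Rightarrow> fst (\<pi> ! m) \<in> F
      | Resolve x i j \<Rightarrow> i < m \<and> j < m \<and>
          (\<exists>B C. fst (\<pi> ! i) = insert (Pos x) B \<and> fst (\<pi> ! j) = insert (Neg x) C \<and>
                 fst (\<pi> ! m) = B \<union> C))"

definition resolution_refutation :: "'v cnf \<Rightarrow> 'v derivation \<Rightarrow> bool" where
  "resolution_refutation F \<pi> \<longleftrightarrow>
     \<pi> \<noteq> [] \<and> (\<forall>m < length \<pi>. valid_step F \<pi> m) \<and> fst (last \<pi>) = {}"

definition premise_of :: "'v derivation \<Rightarrow> nat \<Rightarrow> nat \<Rightarrow> bool" where
  "premise_of \<pi> i m \<longleftrightarrow>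
     i < length \<pi> \<and> m < length \<pi> \<and>
     (\<exists>x j. snd (\<pi> ! m) = Resolve x i j \<or> snd (\<pi> ! m) = Resolve x j i)"

definition source_to_sink_path :: "'v derivation \<Rightarrow> nat list \<Rightarrow> bool" where
  "source_to_sink_path \<pi> ms \<longleftrightarrow>
     ms \<noteq> [] \<and> set ms \<subseteq> {..<length \<pi>} \<and> successively (premise_of \<pi>) ms \<and>
     (\<nexists>i. premise_of \<pi> i (hd ms)) \<and> (\<nexists>m. premise_of \<pi> (last ms) m)"

definition pivot :: "'v derivation \<Rightarrow> nat \<Rightarrow> 'v option" where
  "pivot \<pi> m = (case snd (\<pi> ! m) of Initial \<Rightarrow> None | Resolve x i j \<Rightarrow> Some x)"

definition regular :: "'v derivation \<Rightarrow> bool" where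
  "regular \<pi> \<longleftrightarrow>
     (\<forall>ms. source_to_sink_path \<pi> ms \<longrightarrow> distinct (List.map_filter (pivot \<pi>) ms))"

end

theory Submission
  imports Defs "HOL-Real_Asymp.Real_Asymp"
begin

text \<open>
  Read a regular refutation from the empty clause to the axioms as a read-once branching program
  and follow it with one \<open>\<delta>\<close>-biased coin per vertex: a queried vertex is answered by its coin,
  except that the answer is zero if its block already contains a one or if it is not adjacent to
  every vertex that is one on \<^emph>\<open>all\<close> paths to the current node. Such a walk ends in a block whose
  vertices are all zero, and it sets at most \<open>k\<close> ones. Cut it into segments with at most \<open>T\<close>
  ones each. In a graph where all blocks have many common neighbours of every small set, some
  segment from a node \<open>a\<close> to a node \<open>b\<close> must turn a neighbour-dense subset \<open>U\<close> of the block to zero.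
  Let \<open>R\<close> consist of the vertices known to be one at \<open>a\<close> and the ones of the segment. If \<open>R\<close> has
  many common neighbours in \<open>U\<close>, then all their coins are zero, which is unlikely; otherwise \<open>R\<close>
  meets in at least \<open>r\<close> points a small set \<open>S\<close> that depends only on \<open>U\<close>, and \<open>r\<close> ones inside \<open>S\<close>
  are unlikely. A union bound over all pairs of nodes bounds the length from below.

  In the random graph the set \<open>S\<close> exists for every dense \<open>U\<close>: otherwise one greedily finds many
  small sets, almost disjoint, each of which loses most of the common neighbours in \<open>U\<close> that its
  overlap with the previous ones has. These losses are essentially independent, which beats the
  number of choices for \<open>U\<close> and for the sets. If \<open>k / \<xi>\<^sup>2\<close> is bounded, it is enough that
  every variable of some block is resolved on.
\<close>

section \<open>Regular refutations as read-once branching programs\<close>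

text \<open>The DAG is read from a clause towards its premises, as a search for a falsified clause.
  Answer \<open>True\<close> leads to \<open>j\<close>, whose clause has \<open>Neg x\<close>, and
  \<open>False\<close> to \<open>i\<close>, whose clause has \<open>Pos x\<close>: the pivot literal
  of the chosen premise is false under the answer.\<close>

inductive query_path :: "'v derivation \<Rightarrow> nat \<Rightarrow> ('v \<times> bool) list \<Rightarrow> nat \<Rightarrow> bool"
  for \<pi> where
  query_path_Nil: "query_path \<pi> a [] a"
| query_path_snoc: "query_path \<pi> a \<sigma> b \<Longrightarrow> snd (\<pi> ! b) = Resolve x i j \<Longrightarrow>
    query_path \<pi> a (\<sigma> @ [(x, v)]) (if v then j else i)"

lemma query_path_append:
  assumes "query_path \<pi> b \<tau> c" "query_path \<pi> a \<sigma> b"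
  shows "query_path \<pi> a (\<sigma> @ \<tau>) c"
  using assms
proof (induction rule: query_path.induct)
  case (query_path_snoc b \<tau> c x i j v)
  then show ?case
    using query_path.query_path_snoc[of \<pi> a "\<sigma> @ \<tau>" c x i j v] by simp
qed simp

lemma map_filter_append: "List.map_filter f (xs @ ys) = List.map_filter f xs @ List.map_filter f ys"
  by (simp add: List.map_filter_def)

locale regular_refutation =
  fixes F :: "'v cnf" and \<pi> :: "'v derivation"
  assumes refutation: "resolution_refutation F \<pi>"
    and regular: "regular \<pi>"
begin

definition root :: nat where "root = length \<pi> - 1"

lemma root_less: "root < length \<pi>"
  using refutation by (auto simp: root_def resolution_refutation_def)

lemma clause_root: "fst (\<pi> ! root) = {}"
  using refutation by (auto simp: root_def resolution_refutation_def last_conv_nth)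

lemma valid: "m < length \<pi> \<Longrightarrow> valid_step F \<pi> m"
  using refutation by (auto simp: resolution_refutation_def)

lemma resolve_less:
  assumes "m < length \<pi>" "snd (\<pi> ! m) = Resolve x i j"
  shows "i < m" "j < m"
  using valid[OF assms(1)] assms(2) by (auto simp: valid_step_def)

lemma resolve_clause:
  assumes "m < length \<pi>" "snd (\<pi> ! m) = Resolve x i j"
  shows "fst (\<pi> ! i) \<subseteq> insert (Pos x) (fst (\<pi> ! m))"
    "fst (\<pi> ! j) \<subseteq> insert (Neg x) (fst (\<pi> ! m))"
  using valid[OF assms(1)] assms(2) by (auto simp: valid_step_def)

lemma query_path_less:
  assumes "query_path \<pi> a \<sigma> b" "a < length \<pi>"
  shows "b < length \<pi>"
  using assms
proof (induction rule: query_path.induct)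
  case (query_path_snoc a \<sigma> b x i j v)
  then show ?case using resolve_less[of b x i j] by auto
qed simp

text \<open>The empty clause at the root is falsified trivially, and the chosen premise adds at most
  the pivot literal, which the answer has just made false.\<close>

lemma falsifies:
  assumes "query_path \<pi> root \<sigma> m"
  shows "fst (\<pi> ! m) \<subseteq> {Pos x |x. (x, False) \<in> set \<sigma>} \<union> {Neg x |x. (x, True) \<in> set \<sigma>}"
proof -
  have "query_path \<pi> a \<sigma> m \<Longrightarrow> a = root \<Longrightarrow> ?thesis" for a
  proof (induction rule: query_path.induct)
    case (query_path_Nil a)
    then show ?case by (simp add: clause_root)
  next
    case (query_path_snoc a \<sigma> b x i j v)
    then have "b < length \<pi>" using query_path_less root_less by blast
    then have "fst (\<pi> ! i) \<subseteq> insert (Pos x) (fst (\<pi> ! b))"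
      "fst (\<pi> ! j) \<subseteq> insert (Neg x) (fst (\<pi> ! b))"
      using resolve_clause query_path_snoc.hyps(2) by blast+
    with query_path_snoc.IH[OF query_path_snoc.prems] show ?case by (cases v; simp; blast)
  qed
  then show ?thesis using assms by blast
qed

text \<open>\<open>regular\<close> speaks only of complete source-to-sink paths, so a query path has
  to be completed to one. Its nodes are listed from \<open>m\<close> up to the root;
  \<open>tl\<close> drops \<open>m\<close>, whose pivot has not been answered yet.\<close>

lemma node_path:
  assumes "query_path \<pi> root \<sigma> m"
  shows "\<exists>ms. ms \<noteq> [] \<and> hd ms = m \<and> last ms = root \<and> set ms \<subseteq> {..<length \<pi>} \<and>
    successively (premise_of \<pi>) ms \<and> List.map_filter (pivot \<pi>) (tl ms) = rev (map fst \<sigma>)"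
proof -
  have "query_path \<pi> a \<sigma> m \<Longrightarrow> a = root \<Longrightarrow> ?thesis" for a
  proof (induction rule: query_path.induct)
    case (query_path_Nil a)
    then show ?case using root_less by (intro exI[of _ "[root]"]) (auto simp: map_filter_simps)
  next
    case (query_path_snoc a \<sigma> b x i j v)
    then obtain ms where ms: "ms \<noteq> []" "hd ms = b" "last ms = root" "set ms \<subseteq> {..<length \<pi>}"
      "successively (premise_of \<pi>) ms" "List.map_filter (pivot \<pi>) (tl ms) = rev (map fst \<sigma>)"
      by blast
    from query_path_snoc have b: "b < length \<pi>" using query_path_less root_less by blast
    define c where "c = (if v then j else i)"
    have c: "c < length \<pi>" "premise_of \<pi> c b"
      using resolve_less[OF b query_path_snoc(2)] b query_path_snoc(2)
      by (auto simp: c_def premise_of_def)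
    obtain ms' where ms': "ms = b # ms'" using ms(1,2) by (cases ms) auto
    have "pivot \<pi> b = Some x" using query_path_snoc(2) by (simp add: pivot_def)
    then show ?case unfolding c_def[symmetric] using ms c ms'
      by (intro exI[of _ "c # ms"]) (auto simp: map_filter_simps)
  qed
  then show ?thesis using assms by blast
qed

text \<open>The other half of the completion: premises stand at smaller positions, so descending
  from \<open>m\<close> ends at a source.\<close>

lemma source_path:
  assumes "m < length \<pi>"
  shows "\<exists>ps. ps \<noteq> [] \<and> last ps = m \<and> set ps \<subseteq> {..<length \<pi>} \<and>
    successively (premise_of \<pi>) ps \<and> (\<nexists>i. premise_of \<pi> i (hd ps))"
  using assms
proof (induction m rule: less_induct)
  case (less m)
  show ?case
  proof (cases "snd (\<pi> ! m)")
    case Initial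
    then show ?thesis using less.prems by (intro exI[of _ "[m]"]) (auto simp: premise_of_def)
  next
    case (Resolve x i j)
    have "i < m" using resolve_less less.prems Resolve by blast
    with less obtain ps where ps: "ps \<noteq> []" "last ps = i" "set ps \<subseteq> {..<length \<pi>}"
      "successively (premise_of \<pi>) ps" "\<nexists>i. premise_of \<pi> i (hd ps)"
      by force
    moreover have "premise_of \<pi> i m"
      using \<open>i < m\<close> less.prems Resolve by (auto simp: premise_of_def)
    ultimately show ?thesis using less.prems
      by (intro exI[of _ "ps @ [m]"]) (auto simp: successively_append_iff)
  qed
qed

text \<open>Joining the two halves gives a source-to-sink path on which every answered variable is a
  pivot, and for the second claim the pivot of \<open>m\<close> as well; regularity forbids
  repetitions.\<close>

lemma read_once:
  assumes "query_path \<pi> root \<sigma> m"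
  shows "distinct (map fst \<sigma>)" "snd (\<pi> ! m) = Resolve x i j \<Longrightarrow> x \<notin> fst ` set \<sigma>"
proof -
  obtain ms where ms: "ms \<noteq> []" "hd ms = m" "last ms = root" "set ms \<subseteq> {..<length \<pi>}"
    "successively (premise_of \<pi>) ms" "List.map_filter (pivot \<pi>) (tl ms) = rev (map fst \<sigma>)"
    using node_path[OF assms] by blast
  obtain ms' where ms': "ms = m # ms'" using ms(1,2) by (cases ms) auto
  have "m < length \<pi>" using assms query_path_less root_less by blast
  then obtain ps where ps: "ps \<noteq> []" "last ps = m" "set ps \<subseteq> {..<length \<pi>}"
      "successively (premise_of \<pi>) ps" "\<nexists>i. premise_of \<pi> i (hd ps)"
    using source_path by blast
  \<comment> \<open>The root is the last position and premises stand strictly earlier, so nothing is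
    derived from it.\<close>
  have noprem: "\<not> premise_of \<pi> root b" for b
    using resolve_less[of b] by (force simp: premise_of_def root_def)
  have "last (ps @ ms') = root" using ms(3) ms' ps(2) by (cases ms') auto
  then have "source_to_sink_path \<pi> (ps @ ms')"
    using ms ms' ps noprem
    by (cases ms') (auto simp: source_to_sink_path_def successively_append_iff successively_Cons)
  then have d: "distinct (List.map_filter (pivot \<pi>) ps @ rev (map fst \<sigma>))"
    using regular ms(6) ms' unfolding regular_def by (metis map_filter_append list.sel(3))
  then show "distinct (map fst \<sigma>)" by simp
  assume x: "snd (\<pi> ! m) = Resolve x i j"
  have "x \<in> set (List.map_filter (pivot \<pi>) ps)"
    using ps(2) x last_in_set[OF ps(1)]
    by (auto simp: List.map_filter_def pivot_def image_iff intro!: bexI[of _ m])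
  then show "x \<notin> fst ` set \<sigma>" using d by auto
qed

end

section \<open>Walks guided by coins\<close>

definition common_nbrs :: "'a set set \<Rightarrow> 'a set \<Rightarrow> 'a set \<Rightarrow> 'a set" where
  "common_nbrs E U R = {w \<in> U. \<forall>u\<in>R. {u, w} \<in> E}"

definition nbr_dense :: "'a set set \<Rightarrow> 'a set \<Rightarrow> 'a set \<Rightarrow> nat \<Rightarrow> real \<Rightarrow> bool" where
  "nbr_dense E X U r q \<longleftrightarrow> (\<forall>R. R \<subseteq> X \<and> card R \<le> r \<longrightarrow> q \<le> real (card (common_nbrs E U R)))"

locale clique_refutation = regular_refutation "Clique_block V E k W" \<pi>
  for V :: "'a set" and E k W \<pi> +
  assumes finite_V: "finite V"
    and union_W: "(\<Union>i\<in>{1..k}. W i) = V"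
    and disjoint_W: "disjoint_family_on W {1..k}"
begin

text \<open>Restricting to \<open>V\<close> keeps \<open>known1 a\<close> finite for nodes that no path reaches.\<close>

definition known1 :: "nat \<Rightarrow> 'a set" where
  "known1 a = {x \<in> V. \<forall>\<sigma>. query_path \<pi> root \<sigma> a \<longrightarrow> (x, True) \<in> set \<sigma>}"

definition known0 :: "nat \<Rightarrow> 'a set" where
  "known0 a = {x. \<forall>\<sigma>. query_path \<pi> root \<sigma> a \<longrightarrow> (x, False) \<in> set \<sigma>}"

definition ones :: "('a \<times> bool) list \<Rightarrow> 'a set" where
  "ones \<sigma> = {x. (x, True) \<in> set \<sigma>}"

lemma ones_append [simp]: "ones (\<sigma> @ \<tau>) = ones \<sigma> \<union> ones \<tau>"
  by (auto simp: ones_def)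

lemma finite_ones [simp]: "finite (ones \<sigma>)"
proof (rule finite_subset)
  show "ones \<sigma> \<subseteq> fst ` set \<sigma>" by (force simp: ones_def)
qed simp

lemma known1_subset_ones: "query_path \<pi> root \<sigma> a \<Longrightarrow> known1 a \<subseteq> ones \<sigma>"
  by (auto simp: known1_def ones_def)

text \<open>Any path to \<open>a\<close> can be continued by the fixed segment
  \<open>\<tau>\<close>, so a one common to all paths to \<open>b\<close> that \<open>\<tau>\<close>
  does not set is already common to all paths to \<open>a\<close>.\<close>

lemma known1_segment:
  assumes "query_path \<pi> a \<tau> b"
  shows "known1 b \<subseteq> known1 a \<union> ones \<tau>"
  using query_path_append[OF assms] by (fastforce simp: known1_def ones_def)

lemma known0_segment:
  assumes "query_path \<pi> a \<tau> b" "w \<in> known0 b" "w \<notin> known0 a"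
  shows "(w, False) \<in> set \<tau>"
  using query_path_append[OF assms(1)] assms(2,3) by (fastforce simp: known0_def)

lemma known0_root: "known0 root = {}"
  using query_path_Nil[of \<pi> root] by (force simp: known0_def)

text \<open>The adjacency test looks at the node and not at the history. A segment can then be
  judged from its two end nodes and its own ones, which keeps the union bound down to pairs of
  nodes.\<close>

definition answer :: "('a \<Rightarrow> bool) \<Rightarrow> ('a \<times> bool) list \<Rightarrow> nat \<Rightarrow> 'a \<Rightarrow> bool" where
  "answer c \<sigma> a u \<longleftrightarrow> c u \<and> u \<in> V \<and> (\<forall>i\<in>{1..k}. u \<in> W i \<longrightarrow> ones \<sigma> \<inter> W i = {}) \<and>
     (\<forall>v\<in>known1 a. {v, u} \<in> E)"

inductive walk :: "('a \<Rightarrow> bool) \<Rightarrow> ('a \<times> bool) list \<Rightarrow> nat \<Rightarrow> bool" for c where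
  walk_Nil: "walk c [] root"
| walk_snoc: "walk c \<sigma> a \<Longrightarrow> snd (\<pi> ! a) = Resolve x i j \<Longrightarrow> v = answer c \<sigma> a x \<Longrightarrow>
    walk c (\<sigma> @ [(x, v)]) (if v then j else i)"

lemma walk_query_path: "walk c \<sigma> a \<Longrightarrow> query_path \<pi> root \<sigma> a"
  by (induction rule: walk.induct) (blast intro: query_path.intros)+

lemma walk_less: "walk c \<sigma> a \<Longrightarrow> a < length \<pi>"
  using walk_query_path query_path_less root_less by blast

text \<open>Positions strictly decrease along the walk.\<close>

lemma walk_leaf: "\<exists>\<sigma> a. walk c \<sigma> a \<and> snd (\<pi> ! a) = Initial"
proof -
  have "walk c \<sigma> a \<Longrightarrow> ?thesis" for \<sigma> a
  proof (induction a arbitrary: \<sigma> rule: less_induct)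
    case (less a)
    show ?case
    proof (cases "snd (\<pi> ! a)")
      case (Resolve x i j)
      then show ?thesis
        using less.IH walk_snoc[OF less.prems Resolve refl] resolve_less walk_less less.prems
        by (metis (full_types))
    qed (use less.prems in blast)
  qed
  then show ?thesis using walk_Nil by blast
qed

lemma walk_prefix:
  "walk c (\<sigma> @ \<tau>) b \<Longrightarrow> \<exists>a. walk c \<sigma> a \<and> query_path \<pi> a \<tau> b"
proof (induction \<tau> arbitrary: b rule: rev_induct)
  case Nil
  then show ?case by (auto intro: query_path.intros)
next
  case (snoc e \<tau>)
  from snoc.prems show ?case
  proof (cases rule: walk.cases)
    case (walk_snoc \<sigma>' a x i j v)
    then have "walk c (\<sigma> @ \<tau>) a" "e = (x, v)" by auto
    with snoc.IH obtain a' where "walk c \<sigma> a'" "query_path \<pi> a' \<tau> a" by blast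
    then show ?thesis
      using query_path_snoc[OF _ walk_snoc(4), of a' \<tau> v] walk_snoc \<open>e = (x, v)\<close> by auto
  qed simp
qed

lemma walk_split:
  assumes "walk c (\<sigma> @ (x, v) # \<tau>) b"
  shows "\<exists>a i j. walk c \<sigma> a \<and> snd (\<pi> ! a) = Resolve x i j \<and> v = answer c \<sigma> a x \<and>
    query_path \<pi> (if v then j else i) \<tau> b"
proof -
  have "walk c ((\<sigma> @ [(x, v)]) @ \<tau>) b" using assms by simp
  then obtain d where d: "walk c (\<sigma> @ [(x, v)]) d" "query_path \<pi> d \<tau> b"
    using walk_prefix by blast
  from d(1) show ?thesis
    by (cases rule: walk.cases) (use d(2) in auto)
qed

lemma walk_ones_subset: "walk c \<sigma> a \<Longrightarrow> ones \<sigma> \<subseteq> {v \<in> V. c v}"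
proof (induction rule: walk.induct)
  case walk_Nil
  then show ?case by (simp add: ones_def)
next
  case (walk_snoc \<sigma> a x i j v)
  then show ?case by (auto simp: ones_def answer_def)
qed

text \<open>Breaks the symmetry in conflicts between two ones: \<open>z\<close> is the one queried
  later, where the rule \<open>answer\<close> can be invoked.\<close>

lemma ones_in_order:
  assumes "(u, True) \<in> set \<sigma>" "(v, True) \<in> set \<sigma>" "u \<noteq> v"
  shows "\<exists>y z \<sigma>1 \<sigma>2. {y, z} = {u, v} \<and> \<sigma> = \<sigma>1 @ (z, True) # \<sigma>2 \<and> y \<in> ones \<sigma>1"
proof -
  obtain \<sigma>1 \<sigma>2 where s: "\<sigma> = \<sigma>1 @ (v, True) # \<sigma>2" using assms(2) by (meson split_list)
  show ?thesis
  proof (cases "u \<in> ones \<sigma>1")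
    case True
    then show ?thesis using s by blast
  next
    case False
    then have "(u, True) \<in> set \<sigma>2" using assms s by (auto simp: ones_def)
    then obtain \<sigma>3 \<sigma>4 where "\<sigma>2 = \<sigma>3 @ (u, True) # \<sigma>4" by (meson split_list)
    then have "\<sigma> = (\<sigma>1 @ (v, True) # \<sigma>3) @ (u, True) # \<sigma>4" "v \<in> ones (\<sigma>1 @ (v, True) # \<sigma>3)"
      using s by (auto simp: ones_def)
    then show ?thesis by blast
  qed
qed

lemma walk_ones_block:
  assumes "walk c \<sigma> a" "i \<in> {1..k}" "u \<in> ones \<sigma>" "v \<in> ones \<sigma>" "u \<in> W i" "v \<in> W i"
  shows "u = v"
proof (rule ccontr)
  assume "u \<noteq> v"
  then obtain y z \<sigma>1 \<sigma>2 where yz: "{y, z} = {u, v}" "\<sigma> = \<sigma>1 @ (z, True) # \<sigma>2" "y \<in> ones \<sigma>1"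
    using assms ones_in_order[of u \<sigma> v] unfolding ones_def by blast
  then have "y \<in> W i" "z \<in> W i" using assms by (auto simp: doubleton_eq_iff)
  moreover from yz walk_split[of c \<sigma>1 z True \<sigma>2 a] assms(1) obtain b where "answer c \<sigma>1 b z"
    by blast
  ultimately show False using yz assms(2) by (auto simp: answer_def)
qed

lemma walk_card_ones:
  assumes "walk c \<sigma> a"
  shows "card (ones \<sigma>) \<le> k"
proof -
  have "\<forall>x\<in>ones \<sigma>. \<exists>i\<in>{1..k}. x \<in> W i"
    using walk_ones_subset[OF assms] union_W by blast
  then obtain g where g: "\<forall>x\<in>ones \<sigma>. g x \<in> {1..k} \<and> x \<in> W (g x)" by metis
  then have "inj_on g (ones \<sigma>)"
    using walk_ones_block[OF assms] by (intro inj_onI) metis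
  then have "card (ones \<sigma>) \<le> card {1..k}"
    using g by (intro card_inj_on_le[of g]) auto
  then show ?thesis by simp
qed

text \<open>
  If both ends of a non-edge are known to be one at a leaf, then reading once forces the first
  of them to be known already at the node that queries the second, where the walk answers zero.
\<close>

lemma walk_leaf_clique_axiom:
  assumes w: "walk c \<sigma> a" and "snd (\<pi> ! a) = Initial"
  shows "\<exists>i\<in>{1..k}. fst (\<pi> ! a) = Pos ` W i"
proof -
  have q: "query_path \<pi> root \<sigma> a" using walk_query_path w by blast
  have cl: "fst (\<pi> ! a) \<in> Clique_block V E k W"
    using valid[OF walk_less[OF w]] assms(2) by (simp add: valid_step_def)
  have neg: "(x, True) \<in> set \<tau>" if "Neg x \<in> fst (\<pi> ! a)" "query_path \<pi> root \<tau> a" for x \<tau>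
    using falsifies[OF that(2)] that(1) by blast
  have "fst (\<pi> ! a) \<notin> edge_axioms V E"
  proof
    assume "fst (\<pi> ! a) \<in> edge_axioms V E"
    then obtain u v where uv: "fst (\<pi> ! a) = {Neg u, Neg v}" "u \<in> V" "v \<in> V" "u \<noteq> v" "{u, v} \<notin> E"
      by (auto simp: edge_axioms_def)
    then obtain y z \<sigma>1 \<sigma>2 where yz: "{y, z} = {u, v}" "\<sigma> = \<sigma>1 @ (z, True) # \<sigma>2" "y \<in> ones \<sigma>1"
      using ones_in_order[of u \<sigma> v] neg[OF _ q] by blast
    obtain b i j where b: "walk c \<sigma>1 b" "snd (\<pi> ! b) = Resolve z i j" "answer c \<sigma>1 b z"
      "query_path \<pi> j \<sigma>2 a"
      using walk_split[of c \<sigma>1 z True \<sigma>2 a] yz(2) w by auto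
    have "y \<in> known1 b"
    proof -
      have "(y, True) \<in> set \<tau>" if "query_path \<pi> root \<tau> b" for \<tau>
      proof -
        have "query_path \<pi> root ((\<tau> @ [(z, True)]) @ \<sigma>2) a"
          using query_path_append[OF b(4)] query_path_snoc[OF that b(2), of True]
          by (simp only: if_True)
        then have "(y, True) \<in> set ((\<tau> @ [(z, True)]) @ \<sigma>2)"
          using neg yz(1) uv(1) by (metis doubleton_eq_iff insertCI)
        moreover have "(y, True) \<notin> set \<sigma>2" "y \<noteq> z"
          using read_once(1)[OF q] yz(2,3) by (force simp: ones_def)+
        ultimately show ?thesis by auto
      qed
      moreover have "y \<in> V" using yz(1) uv by (auto simp: doubleton_eq_iff)
      ultimately show ?thesis by (auto simp: known1_def)
    qed
    then show False using b(3) yz(1) uv(5) by (auto simp: answer_def)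
  qed
  moreover have "fst (\<pi> ! a) \<notin> functionality_axioms k W"
  proof
    assume "fst (\<pi> ! a) \<in> functionality_axioms k W"
    then obtain i u v where uv: "fst (\<pi> ! a) = {Neg u, Neg v}" "u \<noteq> v" "i \<in> {1..k}" "u \<in> W i" "v \<in> W i"
      by (auto simp: functionality_axioms_def)
    then show False using walk_ones_block[OF w, of i u v] neg[OF _ q] by (auto simp: ones_def)
  qed
  ultimately show ?thesis using cl by (auto simp: Clique_block_def clique_axioms_def)
qed

text \<open>The leaf carries a clique axiom, and every path to it, not only the walk, falsifies
  it.\<close>

lemma walk_zero_block:
  obtains \<sigma> a i where "walk c \<sigma> a" "i \<in> {1..k}" "W i \<subseteq> known0 a"
proof -
  obtain \<sigma> a where w: "walk c \<sigma> a" "snd (\<pi> ! a) = Initial" using walk_leaf by blast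
  with walk_leaf_clique_axiom obtain i where i: "i \<in> {1..k}" "fst (\<pi> ! a) = Pos ` W i" by blast
  have "W i \<subseteq> known0 a"
    unfolding known0_def using falsifies i(2) by fastforce
  with that w i show thesis by blast
qed

lemma query_path_length:
  assumes "query_path \<pi> a \<sigma> b" "a < length \<pi>"
  shows "length \<sigma> + b \<le> a"
  using assms
proof (induction rule: query_path.induct)
  case (query_path_snoc a \<sigma> b x i j v)
  then have "b < length \<pi>" using query_path_less by blast
  then show ?case
    using query_path_snoc resolve_less[of b x i j] by (cases v) auto
qed simp

text \<open>A bound valid for every graph, used when \<open>k / \<xi>\<^sup>2\<close> is bounded.
  Any walk ends where some block has been queried completely, and its path cannot have more queries
  than there are positions.\<close>

lemma block_card_le_length: "\<exists>i\<in>{1..k}. card (W i) \<le> length \<pi>"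
proof -
  obtain \<sigma> a i where w: "walk (\<lambda>_. False) \<sigma> a" "i \<in> {1..k}" "W i \<subseteq> known0 a"
    using walk_zero_block by blast
  have q: "query_path \<pi> root \<sigma> a" using walk_query_path w(1) by blast
  then have "W i \<subseteq> fst ` set \<sigma>" using w(3) by (force simp: known0_def)
  then have "card (W i) \<le> card (fst ` set \<sigma>)" by (simp add: card_mono)
  also have "\<dots> \<le> length \<sigma>" using card_image_le card_length le_trans by (metis List.finite_set)
  also have "\<dots> \<le> length \<pi>" using query_path_length[OF q root_less] root_less by linarith
  finally show ?thesis using w(2) by blast
qed

end

section \<open>The length bound for a fixed graph\<close>

text \<open>A set with at most \<open>M\<close> elements is read off a list of length
  \<open>M\<close> over \<open>V\<close> and one padding symbol \<open>None\<close>.\<close>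

lemma card_bounded_subsets:
  assumes "finite V"
  shows "card {R. R \<subseteq> V \<and> card R \<le> M} \<le> (card V + 1) ^ M"
proof -
  let ?L = "{xs. set xs \<subseteq> insert None (Some ` V) \<and> length xs = M}"
  have "{R. R \<subseteq> V \<and> card R \<le> M} \<subseteq> (\<lambda>xs. {x. Some x \<in> set xs}) ` ?L"
  proof
    fix R assume "R \<in> {R. R \<subseteq> V \<and> card R \<le> M}"
    then have R: "R \<subseteq> V" "card R \<le> M" "finite R" using assms finite_subset by auto
    obtain xs where xs: "set xs = R" "distinct xs" using finite_distinct_list[OF R(3)] by blast
    then have "length xs \<le> M" using R(2) distinct_card by metis
    with xs R show "R \<in> (\<lambda>xs. {x. Some x \<in> set xs}) ` ?L"
      by (intro image_eqI[of _ _ "map Some xs @ replicate (M - length xs) None"]) auto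
  qed
  then have "card {R. R \<subseteq> V \<and> card R \<le> M} \<le> card ?L"
    using assms by (intro surj_card_le finite_lists_length_eq) auto
  also have "\<dots> = card (insert None (Some ` V)) ^ M" using assms by (intro card_lists_length_eq) auto
  also have "card (insert None (Some ` V)) = card V + 1"
    using assms by (simp add: card_insert_if card_image)
  finally show ?thesis .
qed

section \<open>Events of independent biased coins\<close>

lemma prob_coins_const:
  assumes "finite V" "X \<subseteq> V" "0 \<le> \<delta>" "\<delta> \<le> 1"
  shows "measure_pmf.prob (Pi_pmf V False (\<lambda>_. bernoulli_pmf \<delta>)) {c. \<forall>v\<in>X. c v = b} =
    (if b then \<delta> else 1 - \<delta>) ^ card X"
proof -
  have "{c. \<forall>v\<in>X. c v = b} = Pi V (\<lambda>v. if v \<in> X then {b} else UNIV)"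
    using assms(2) by (auto simp: Pi_def split: if_splits)
  then have "measure_pmf.prob (Pi_pmf V False (\<lambda>_. bernoulli_pmf \<delta>)) {c. \<forall>v\<in>X. c v = b} =
    (\<Prod>v\<in>V. measure_pmf.prob (bernoulli_pmf \<delta>) (if v \<in> X then {b} else UNIV))"
    using assms(1) by (simp add: measure_Pi_pmf_Pi)
  also have "\<dots> = (\<Prod>v\<in>V. if v \<in> X then (if b then \<delta> else 1 - \<delta>) else 1)"
    using assms by (intro prod.cong) (auto simp: measure_pmf_single)
  also have "\<dots> = (if b then \<delta> else 1 - \<delta>) ^ card X"
    using assms by (simp add: prod.If_cases Int_absorb1)
  finally show ?thesis .
qed

text \<open>Union bound over the \<open>r\<close>-subsets of \<open>S\<close> that could be all
  heads; \<open>card S choose r\<close> is at most \<open>card S ^ r\<close>.\<close>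

lemma prob_many_heads:
  fixes \<delta> :: real
  assumes "finite V" "S \<subseteq> V" "0 \<le> \<delta>" "\<delta> \<le> 1"
  shows "measure_pmf.prob (Pi_pmf V False (\<lambda>_. bernoulli_pmf \<delta>)) {c. r \<le> card {v \<in> S. c v}}
    \<le> (card S * \<delta>) ^ r"
proof -
  let ?P = "Pi_pmf V False (\<lambda>_. bernoulli_pmf \<delta>)"
  let ?X = "{X. X \<subseteq> S \<and> card X = r}"
  have finS: "finite S" using assms finite_subset by blast
  have "{c. r \<le> card {v \<in> S. c v}} \<subseteq> (\<Union>X\<in>?X. {c. \<forall>v\<in>X. c v = True})"
  proof
    fix c assume "c \<in> {c. r \<le> card {v \<in> S. c v}}"
    then obtain X where "X \<subseteq> {v \<in> S. c v}" "card X = r"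
      using obtain_subset_with_card_n by (metis mem_Collect_eq)
    then show "c \<in> (\<Union>X\<in>?X. {c. \<forall>v\<in>X. c v = True})" by auto
  qed
  then have "measure_pmf.prob ?P {c. r \<le> card {v \<in> S. c v}}
      \<le> measure_pmf.prob ?P (\<Union>X\<in>?X. {c. \<forall>v\<in>X. c v = True})"
    by (intro measure_pmf.finite_measure_mono) auto
  also have "\<dots> \<le> (\<Sum>X\<in>?X. measure_pmf.prob ?P {c. \<forall>v\<in>X. c v = True})"
    using finS by (intro measure_UNION_le) auto
  also have "\<dots> = (\<Sum>X\<in>?X. \<delta> ^ r)"
  proof (rule sum.cong)
    fix X assume "X \<in> ?X"
    then have "X \<subseteq> V" "card X = r" using assms(2) by auto
    then show "measure_pmf.prob ?P {c. \<forall>v\<in>X. c v = True} = \<delta> ^ r"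
      using prob_coins_const[of V X \<delta> True] assms by simp
  qed simp
  also have "\<dots> = real (card S choose r) * \<delta> ^ r" using n_subsets[OF finS] by simp
  also have "\<dots> \<le> real (card S) ^ r * \<delta> ^ r"
  proof (rule mult_right_mono)
    have "card S choose r \<le> card S ^ r" by (cases "r \<le> card S") (auto simp: binomial_le_pow binomial_eq_0)
    then show "real (card S choose r) \<le> real (card S) ^ r" by (metis of_nat_le_iff of_nat_power)
  qed (use assms in simp)
  finally show ?thesis by (simp add: power_mult_distrib)
qed

text \<open>Split on the number of common neighbours. If \<open>R\<close> has at least
  \<open>q'\<close> of them, all their coins are zero with probability at most
  \<open>exp (- \<delta> * q')\<close>, and there are at most \<open>(card V + 1) ^ M\<close> such
  \<open>R\<close>. Otherwise \<open>R\<close> puts \<open>r\<close> heads into \<open>S\<close>; as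
  \<open>S\<close> does not depend on \<open>R\<close>, this is a single event.\<close>

lemma prob_blocked_clique:
  assumes V: "finite V" "X \<subseteq> V" "U \<subseteq> V" and \<delta>: "0 \<le> \<delta>" "\<delta> \<le> 1"
    and S: "S \<subseteq> V" "card S \<le> s"
      "\<And>R. R \<subseteq> X \<Longrightarrow> card R \<le> M \<Longrightarrow> real (card (common_nbrs E U R)) < q' \<Longrightarrow> r \<le> card (R \<inter> S)"
  shows "measure_pmf.prob (Pi_pmf V False (\<lambda>_. bernoulli_pmf \<delta>))
      {c. \<exists>R. R \<subseteq> X \<and> card R \<le> M \<and> (\<forall>v\<in>R. c v) \<and> (\<forall>w\<in>common_nbrs E U R. \<not> c w)}
    \<le> (real s * \<delta>) ^ r + real ((card V + 1) ^ M) * exp (- \<delta> * q')"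
proof -
  let ?P = "Pi_pmf V False (\<lambda>_. bernoulli_pmf \<delta>)"
  let ?R = "{R. R \<subseteq> V \<and> card R \<le> M}"
  let ?R' = "{R \<in> ?R. q' \<le> real (card (common_nbrs E U R))}"
  let ?Z = "\<lambda>R. {c. \<forall>w\<in>common_nbrs E U R. c w = False}"
  have fin: "finite ?R" using V(1) by (auto intro: finite_subset[of _ "Pow V"])
  have fin': "finite ?R'" by (rule finite_subset[OF _ fin]) auto
  have finS: "finite S" using V S finite_subset by blast
  have "{c. \<exists>R. R \<subseteq> X \<and> card R \<le> M \<and> (\<forall>v\<in>R. c v) \<and> (\<forall>w\<in>common_nbrs E U R. \<not> c w)}
      \<subseteq> {c. r \<le> card {v \<in> S. c v}} \<union> (\<Union>R\<in>?R'. ?Z R)"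
  proof
    fix c
    assume "c \<in> {c. \<exists>R. R \<subseteq> X \<and> card R \<le> M \<and> (\<forall>v\<in>R. c v) \<and> (\<forall>w\<in>common_nbrs E U R. \<not> c w)}"
    then obtain R where R: "R \<subseteq> X" "card R \<le> M" "\<forall>v\<in>R. c v" "\<forall>w\<in>common_nbrs E U R. \<not> c w"
      by blast
    show "c \<in> {c. r \<le> card {v \<in> S. c v}} \<union> (\<Union>R\<in>?R'. ?Z R)"
    proof (cases "q' \<le> real (card (common_nbrs E U R))")
      case True
      then have "R \<in> ?R'" "c \<in> ?Z R" using R V(2) by auto
      then show ?thesis by blast
    next
      case False
      then have "r \<le> card (R \<inter> S)" using S(3) R by simp
      also have "\<dots> \<le> card {v \<in> S. c v}" using R finS by (intro card_mono) auto
      finally show ?thesis by simp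
    qed
  qed
  then have "measure_pmf.prob ?P
      {c. \<exists>R. R \<subseteq> X \<and> card R \<le> M \<and> (\<forall>v\<in>R. c v) \<and> (\<forall>w\<in>common_nbrs E U R. \<not> c w)}
      \<le> measure_pmf.prob ?P ({c. r \<le> card {v \<in> S. c v}} \<union> (\<Union>R\<in>?R'. ?Z R))"
    by (intro measure_pmf.finite_measure_mono) auto
  also have "\<dots> \<le> measure_pmf.prob ?P {c. r \<le> card {v \<in> S. c v}} + measure_pmf.prob ?P (\<Union>R\<in>?R'. ?Z R)"
    by (intro measure_Un_le) auto
  also have "measure_pmf.prob ?P {c. r \<le> card {v \<in> S. c v}} \<le> (real s * \<delta>) ^ r"
  proof -
    have "(real (card S) * \<delta>) ^ r \<le> (real s * \<delta>) ^ r"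
      using S(2) \<delta> by (intro power_mono mult_right_mono) auto
    then show ?thesis using prob_many_heads[OF V(1) S(1) \<delta>, of r] by linarith
  qed
  also have "measure_pmf.prob ?P (\<Union>R\<in>?R'. ?Z R) \<le> (\<Sum>R\<in>?R'. measure_pmf.prob ?P (?Z R))"
    using fin' by (intro measure_UNION_le) auto
  also have "\<dots> \<le> (\<Sum>R\<in>?R'. exp (- \<delta> * q'))"
  proof (rule sum_mono)
    fix R assume R: "R \<in> ?R'"
    have "common_nbrs E U R \<subseteq> V" using V(3) by (auto simp: common_nbrs_def)
    then have "measure_pmf.prob ?P (?Z R) = (1 - \<delta>) ^ card (common_nbrs E U R)"
      using prob_coins_const[OF V(1) _ \<delta>, of "common_nbrs E U R" False] by simp
    also have "\<dots> \<le> exp (- \<delta>) ^ card (common_nbrs E U R)"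
      using exp_ge_add_one_self[of "- \<delta>"] \<delta> by (intro power_mono) auto
    also have "\<dots> = exp (- \<delta> * card (common_nbrs E U R))" by (simp add: exp_of_nat_mult[symmetric] mult.commute)
    also have "\<dots> \<le> exp (- \<delta> * q')" using R \<delta> by (auto intro: mult_left_mono)
    finally show "measure_pmf.prob ?P (?Z R) \<le> exp (- \<delta> * q')" .
  qed
  also have "\<dots> = real (card ?R') * exp (- \<delta> * q')" by simp
  also have "\<dots> \<le> real ((card V + 1) ^ M) * exp (- \<delta> * q')"
  proof (rule mult_right_mono)
    have "card ?R' \<le> card ?R" using fin by (intro card_mono) auto
    also have "\<dots> \<le> (card V + 1) ^ M" by (rule card_bounded_subsets[OF V(1)])
    finally show "real (card ?R') \<le> real ((card V + 1) ^ M)" by linarith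
  qed simp
  finally show ?thesis by simp
qed

section \<open>Walks under coins that avoid all bad events\<close>

context clique_refutation
begin

text \<open>Used to identify the node that \<open>walk_prefix\<close> cuts out of a walk with the
  given start of a segment.\<close>

lemma walk_deterministic: "walk c \<sigma> a \<Longrightarrow> walk c \<sigma> b \<Longrightarrow> a = b"
proof (induction \<sigma> arbitrary: a b rule: rev_induct)
  case Nil
  then show ?case by (auto elim: walk.cases)
next
  case (snoc e \<sigma>)
  obtain x v where e: "e = (x, v)" by force
  have "\<exists>a' i j. walk c \<sigma> a' \<and> snd (\<pi> ! a') = Resolve x i j \<and> v = answer c \<sigma> a' x \<and>
      d = (if v then j else i)" if "walk c (\<sigma> @ [e]) d" for d
    using that e by (cases rule: walk.cases) auto
  from this[OF snoc.prems(1)] this[OF snoc.prems(2)] snoc.IH show ?case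
    by (metis inference.inject)
qed

lemma finite_W: "i \<in> {1..k} \<Longrightarrow> finite (W i)"
  using finite_V union_W UN_upper[of i "{1..k}" W] by (metis finite_subset)

text \<open>Each query adds at most one new one, so the count passes through every smaller
  value.\<close>

lemma ones_prefix_card:
  "y \<le> card (ones \<sigma>) \<Longrightarrow> \<exists>\<sigma>1 \<sigma>2. \<sigma> = \<sigma>1 @ \<sigma>2 \<and> card (ones \<sigma>1) = y"
proof (induction \<sigma> rule: rev_induct)
  case Nil
  then show ?case by (simp add: ones_def)
next
  case (snoc e \<sigma>)
  show ?case
  proof (cases "y = card (ones (\<sigma> @ [e]))")
    case True
    then show ?thesis by (metis append_Nil2)
  next
    case False
    have "ones (\<sigma> @ [e]) \<subseteq> insert (fst e) (ones \<sigma>)" by (auto simp: ones_def)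
    then have "card (ones (\<sigma> @ [e])) \<le> card (insert (fst e) (ones \<sigma>))"
      by (intro card_mono) auto
    also have "\<dots> \<le> Suc (card (ones \<sigma>))" by (simp add: card_insert_if)
    finally have "card (ones (\<sigma> @ [e])) \<le> Suc (card (ones \<sigma>))" .
    with False snoc.prems have "y \<le> card (ones \<sigma>)" by linarith
    with snoc.IH show ?thesis by (metis append_assoc)
  qed
qed

text \<open>The coins are fixed outside the bad events: no node has \<open>T\<close> known ones that
  are all heads, and no dense set of new zeros is blocked by few heads. Both conditions mention
  nodes only, never walks, so that a union bound can establish them.\<close>

context
  fixes c :: "'a \<Rightarrow> bool" and l T r M :: nat and q :: real
  assumes few_known1: "\<And>a. a < length \<pi> \<Longrightarrow> \<forall>v\<in>known1 a. c v \<Longrightarrow> card (known1 a) < T"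
    and hits: "\<And>a b i R. \<lbrakk>a < length \<pi>; b < length \<pi>; i \<in> {1..k};
        nbr_dense E (V - W i) (W i \<inter> (known0 b - known0 a)) r q;
        R \<subseteq> V - W i; card R \<le> M; \<forall>v\<in>R. c v\<rbrakk>
      \<Longrightarrow> \<exists>w\<in>common_nbrs E (W i \<inter> (known0 b - known0 a)) R. c w"
    and T: "2 * T \<le> M"
begin

text \<open>Otherwise \<open>hits\<close>, applied to the vertices known to be one at
  \<open>a\<close> and the ones of the segment, gives a vertex \<open>w\<close> with coin one that
  is adjacent to all of them and becomes zero within the segment. But when \<open>w\<close> is
  queried, its block has no one and all known ones lie in \<open>R\<close>, so the walk would have
  answered one.\<close>

lemma segment_not_dense:
  assumes "walk c \<sigma> a" "query_path \<pi> a \<tau> b" "walk c (\<sigma> @ \<tau>) b" "i \<in> {1..k}"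
    "ones (\<sigma> @ \<tau>) \<inter> W i = {}" "card (ones \<tau>) \<le> T"
  shows "\<not> nbr_dense E (V - W i) (W i \<inter> (known0 b - known0 a)) r q"
proof
  assume dense: "nbr_dense E (V - W i) (W i \<inter> (known0 b - known0 a)) r q"
  define R where "R = known1 a \<union> ones \<tau>"
  have sub: "known1 a \<subseteq> ones \<sigma>" using known1_subset_ones walk_query_path assms(1) by blast
  have ones: "ones (\<sigma> @ \<tau>) \<subseteq> {v \<in> V. c v}" using walk_ones_subset assms(3) by blast
  have "card (known1 a) < T" using few_known1[OF walk_less[OF assms(1)]] sub ones by auto
  \<comment> \<open>Fewer than \<open>T\<close> known ones and at most \<open>T\<close> ones of the
    segment: this is what \<open>2 * T \<le> M\<close> is for.\<close>
  then have "card R \<le> M"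
    using card_Un_le[of "known1 a" "ones \<tau>"] assms(6) T by (simp add: R_def)
  moreover have "R \<subseteq> V - W i" "\<forall>v\<in>R. c v"
    using sub ones assms(5) by (auto simp: R_def)
  ultimately obtain w where w: "w \<in> common_nbrs E (W i \<inter> (known0 b - known0 a)) R" "c w"
    using hits[OF walk_less[OF assms(1)] walk_less[OF assms(3)] assms(4) dense] by blast
  then have wi: "w \<in> W i" "w \<in> V" using assms(4) union_W by (auto simp: common_nbrs_def)
  have "(w, False) \<in> set \<tau>"
    using w(1) known0_segment[OF assms(2)] by (auto simp: common_nbrs_def)
  then obtain \<tau>1 \<tau>2 where \<tau>: "\<tau> = \<tau>1 @ (w, False) # \<tau>2" by (meson split_list)
  then obtain d where d: "walk c (\<sigma> @ \<tau>1) d" "\<not> answer c (\<sigma> @ \<tau>1) d w"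
    using walk_split[of c "\<sigma> @ \<tau>1" w False \<tau>2 b] assms(3) by auto
  obtain a' where "walk c \<sigma> a'" "query_path \<pi> a' \<tau>1 d" using walk_prefix d(1) by blast
  then have "query_path \<pi> a \<tau>1 d" using walk_deterministic assms(1) by blast
  then have "known1 d \<subseteq> R" using known1_segment by (force simp: R_def \<tau>)
  then have "\<forall>v\<in>known1 d. {v, w} \<in> E" using w(1) by (auto simp: common_nbrs_def)
  moreover have "ones (\<sigma> @ \<tau>1) \<inter> W i' = {}" if "i' \<in> {1..k}" "w \<in> W i'" for i'
  proof -
    have "i' = i" using disjoint_W that wi(1) assms(4) unfolding disjoint_family_on_def by blast
    then show ?thesis using assms(5) \<tau> by auto
  qed
  ultimately show False using d(2) w(2) wi(2) by (auto simp: answer_def)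
qed

text \<open>Induction over segments with at most \<open>T\<close> ones. The new zeros of each
  segment are left with fewer than \<open>q\<close> common neighbours by some set of at most
  \<open>r\<close> vertices. The union of these sets serves all zeros at once, so sizes and
  neighbour counts add up. The initial segment without ones makes it \<open>Suc l\<close>.\<close>

lemma known0_not_dense:
  assumes "walk c \<sigma> b" "i \<in> {1..k}" "ones \<sigma> \<inter> W i = {}" "card (ones \<sigma>) \<le> l * T" "q > 0"
  shows "\<exists>R. R \<subseteq> V - W i \<and> card R \<le> Suc l * r \<and>
    real (card (common_nbrs E (W i \<inter> known0 b) R)) < real (Suc l) * q"
  using assms
proof (induction l arbitrary: \<sigma> b)
  case 0
  have "\<not> nbr_dense E (V - W i) (W i \<inter> (known0 b - known0 root)) r q"
    using 0 walk_query_path by (intro segment_not_dense[OF walk_Nil, of \<sigma>]) auto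
  then show ?case by (auto simp: nbr_dense_def known0_root not_le)
next
  case (Suc l)
  show ?case
  proof (cases "card (ones \<sigma>) \<le> l * T")
    case True
    with Suc obtain R where R: "R \<subseteq> V - W i" "card R \<le> Suc l * r"
      "real (card (common_nbrs E (W i \<inter> known0 b) R)) < real (Suc l) * q" by blast
    have "real (Suc l) * q \<le> real (Suc (Suc l)) * q" using Suc.prems(5) by simp
    moreover have "Suc l * r \<le> Suc (Suc l) * r" by simp
    ultimately show ?thesis using R by (intro exI[of _ R] conjI) linarith+
  next
    case False
    then obtain \<sigma>1 \<sigma>2 where s: "\<sigma> = \<sigma>1 @ \<sigma>2" "card (ones \<sigma>1) = l * T"
      using ones_prefix_card[of "l * T" \<sigma>] by auto
    then obtain a where a: "walk c \<sigma>1 a" "query_path \<pi> a \<sigma>2 b" using walk_prefix Suc.prems(1) by blast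
    have "distinct (map fst \<sigma>)" using read_once(1) walk_query_path Suc.prems(1) by blast
    then have "ones \<sigma>1 \<inter> ones \<sigma>2 = {}" by (force simp: s(1) ones_def)
    then have "card (ones \<sigma>) = l * T + card (ones \<sigma>2)" using s by (simp add: card_Un_disjoint)
    then have "card (ones \<sigma>2) \<le> T" using Suc.prems(4) by simp
    then have "\<not> nbr_dense E (V - W i) (W i \<inter> (known0 b - known0 a)) r q"
      using Suc.prems s a by (intro segment_not_dense[of \<sigma>1 a \<sigma>2]) auto
    then obtain R2 where R2: "R2 \<subseteq> V - W i" "card R2 \<le> r"
      "real (card (common_nbrs E (W i \<inter> (known0 b - known0 a)) R2)) < q"
      by (auto simp: nbr_dense_def not_le)
    have "ones \<sigma>1 \<inter> W i = {}" using Suc.prems(3) s(1) by auto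
    then obtain R1 where R1: "R1 \<subseteq> V - W i" "card R1 \<le> Suc l * r"
      "real (card (common_nbrs E (W i \<inter> known0 a) R1)) < real (Suc l) * q"
      using Suc.IH[OF a(1)] Suc.prems s(2) by auto
    have "card (common_nbrs E (W i \<inter> known0 b) (R1 \<union> R2)) \<le>
      card (common_nbrs E (W i \<inter> known0 a) R1 \<union> common_nbrs E (W i \<inter> (known0 b - known0 a)) R2)"
      using finite_W[OF Suc.prems(2)] by (intro card_mono) (auto simp: common_nbrs_def)
    also have "\<dots> \<le> card (common_nbrs E (W i \<inter> known0 a) R1) +
        card (common_nbrs E (W i \<inter> (known0 b - known0 a)) R2)"
      by (rule card_Un_le)
    finally have "real (card (common_nbrs E (W i \<inter> known0 b) (R1 \<union> R2))) < real (Suc (Suc l)) * q"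
      using R1(3) R2(3) by (simp add: algebra_simps)
    then show ?thesis
      using R1(1,2) R2(1,2) card_Un_le[of R1 R2] by (intro exI[of _ "R1 \<union> R2"]) auto
  qed
qed

text \<open>The walk ends where a whole block is zero, so \<open>known0_not_dense\<close> applies to
  the full block, against its assumed common neighbours.\<close>

lemma coins_contradiction:
  assumes "k \<le> l * T" "q > 0"
    and blocks: "\<And>i R. i \<in> {1..k} \<Longrightarrow> R \<subseteq> V - W i \<Longrightarrow> card R \<le> Suc l * r \<Longrightarrow>
      real (Suc l) * q \<le> real (card (common_nbrs E (W i) R))"
  shows False
proof -
  obtain \<sigma> a i where w: "walk c \<sigma> a" "i \<in> {1..k}" "W i \<subseteq> known0 a" using walk_zero_block by blast
  have q: "query_path \<pi> root \<sigma> a" using walk_query_path w(1) by blast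
  \<comment> \<open>A variable answered zero on the path is not answered one as well, since it is
    queried once.\<close>
  have "ones \<sigma> \<inter> W i = {}"
    using read_once(1)[OF q] w(3) q by (force simp: ones_def known0_def distinct_map inj_on_def)
  moreover have "card (ones \<sigma>) \<le> l * T" using walk_card_ones[OF w(1)] assms(1) by simp
  ultimately obtain R where "R \<subseteq> V - W i" "card R \<le> Suc l * r"
    "real (card (common_nbrs E (W i \<inter> known0 a) R)) < real (Suc l) * q"
    using known0_not_dense[OF w(1,2) _ _ assms(2)] by blast
  moreover have "W i \<inter> known0 a = W i" using w(3) by auto
  ultimately show False using blocks[OF w(2)] by (metis not_le)
qed

end

text \<open>Union bound over the \<open>length \<pi>\<close> nodes for the first kind of bad event
  and over \<open>(length \<pi>)\<^sup>2 * k\<close> triples of two nodes and a block for the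
  second. If the right-hand side were below 1, some outcome of the coins would avoid them all,
  against \<open>coins_contradiction\<close>.\<close>

lemma length_bound:
  fixes \<delta> q q' :: real
  assumes "k \<le> l * T" "q > 0" "2 * T \<le> M" and \<delta>: "0 \<le> \<delta>" "\<delta> \<le> 1"
    and blocks: "\<And>i R. i \<in> {1..k} \<Longrightarrow> R \<subseteq> V - W i \<Longrightarrow> card R \<le> Suc l * r \<Longrightarrow>
      real (Suc l) * q \<le> real (card (common_nbrs E (W i) R))"
    and mostly: "\<And>i U. i \<in> {1..k} \<Longrightarrow> U \<subseteq> W i \<Longrightarrow> nbr_dense E (V - W i) U r q \<Longrightarrow>
      \<exists>S\<subseteq>V. card S \<le> s \<and> (\<forall>R. R \<subseteq> V - W i \<and> card R \<le> M \<and>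
        real (card (common_nbrs E U R)) < q' \<longrightarrow> r \<le> card (R \<inter> S))"
  shows "1 \<le> real (length \<pi>) * \<delta> ^ T + real ((length \<pi>)\<^sup>2 * k) *
    ((real s * \<delta>) ^ r + real ((card V + 1) ^ M) * exp (- \<delta> * q'))"
proof (rule ccontr)
  let ?P = "Pi_pmf V False (\<lambda>_. bernoulli_pmf \<delta>)"
  let ?L = "length \<pi>"
  let ?U = "\<lambda>a b i. W i \<inter> (known0 b - known0 a)"
  let ?x = "(real s * \<delta>) ^ r + real ((card V + 1) ^ M) * exp (- \<delta> * q')"
  define I1 where "I1 = {a. a < ?L \<and> T \<le> card (known1 a)}"
  define B1 where "B1 = (\<lambda>a. {c. \<forall>v\<in>known1 a. c v = True})"
  define I2 where "I2 = {z \<in> {..<?L} \<times> {..<?L} \<times> {1..k}. case z of (a, b, i) \<Rightarrow>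
    nbr_dense E (V - W i) (?U a b i) r q}"
  define B2 where "B2 = (\<lambda>(a, b, i). {c. \<exists>R. R \<subseteq> V - W i \<and> card R \<le> M \<and> (\<forall>v\<in>R. c v) \<and>
    (\<forall>w\<in>common_nbrs E (?U a b i) R. \<not> c w)})"
  have fin: "finite I1" "finite I2" by (auto simp: I1_def I2_def)
  assume neg: "\<not> ?thesis"
  have "measure_pmf.prob ?P ((\<Union>a\<in>I1. B1 a) \<union> (\<Union>z\<in>I2. B2 z)) \<le>
      measure_pmf.prob ?P (\<Union>a\<in>I1. B1 a) + measure_pmf.prob ?P (\<Union>z\<in>I2. B2 z)"
    by (intro measure_Un_le) auto
  also have "measure_pmf.prob ?P (\<Union>a\<in>I1. B1 a) \<le> (\<Sum>a\<in>I1. measure_pmf.prob ?P (B1 a))"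
    using fin by (intro measure_UNION_le) auto
  also have "\<dots> \<le> (\<Sum>a\<in>I1. \<delta> ^ T)"
  proof (rule sum_mono)
    fix a assume "a \<in> I1"
    then have "T \<le> card (known1 a)" "known1 a \<subseteq> V" by (auto simp: I1_def known1_def)
    then show "measure_pmf.prob ?P (B1 a) \<le> \<delta> ^ T"
      using prob_coins_const[OF finite_V _ \<delta>, of "known1 a" True] power_decreasing[OF _ \<delta>]
      by (simp add: B1_def)
  qed
  also have "\<dots> \<le> real ?L * \<delta> ^ T"
  proof -
    have "card I1 \<le> card {..<?L}" by (intro card_mono) (auto simp: I1_def)
    then show ?thesis using \<delta> by (simp add: mult_right_mono)
  qed
  also have "measure_pmf.prob ?P (\<Union>z\<in>I2. B2 z) \<le> (\<Sum>z\<in>I2. measure_pmf.prob ?P (B2 z))"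
    using fin by (intro measure_UNION_le) auto
  also have "\<dots> \<le> (\<Sum>z\<in>I2. ?x)"
  proof (rule sum_mono)
    fix z assume "z \<in> I2"
    then obtain a b i where z: "z = (a, b, i)" "i \<in> {1..k}" "nbr_dense E (V - W i) (?U a b i) r q"
      by (auto simp: I2_def)
    then obtain S where S: "S \<subseteq> V" "card S \<le> s"
      "\<And>R. R \<subseteq> V - W i \<Longrightarrow> card R \<le> M \<Longrightarrow> real (card (common_nbrs E (?U a b i) R)) < q' \<Longrightarrow>
        r \<le> card (R \<inter> S)"
      using mostly[OF z(2) _ z(3)] by blast
    have "?U a b i \<subseteq> V" using z(2) union_W by auto
    then show "measure_pmf.prob ?P (B2 z) \<le> ?x"
      using prob_blocked_clique[OF finite_V _ _ \<delta> S] by (simp add: B2_def z(1))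
  qed
  also have "\<dots> \<le> real (?L\<^sup>2 * k) * ?x"
  proof -
    have "card I2 \<le> card ({..<?L} \<times> {..<?L} \<times> {1..k})" by (intro card_mono) (auto simp: I2_def)
    then have "real (card I2) \<le> real (?L\<^sup>2 * k)"
      by (simp only: of_nat_le_iff) (simp add: power2_eq_square)
    then show ?thesis using \<delta> by (simp only: sum_constant) (intro mult_right_mono, auto)
  qed
  finally have "measure_pmf.prob ?P ((\<Union>a\<in>I1. B1 a) \<union> (\<Union>z\<in>I2. B2 z)) < 1" using neg by linarith
  then have "(\<Union>a\<in>I1. B1 a) \<union> (\<Union>z\<in>I2. B2 z) \<noteq> UNIV" by force
  then obtain c where c: "\<And>a. a \<in> I1 \<Longrightarrow> c \<notin> B1 a" "\<And>z. z \<in> I2 \<Longrightarrow> c \<notin> B2 z" by blast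
  show False
  proof (rule coins_contradiction[of c T r q M l])
    show "card (known1 a) < T" if "a < ?L" "\<forall>v\<in>known1 a. c v" for a
      using that c(1)[of a] by (cases "T \<le> card (known1 a)") (auto simp: I1_def B1_def)
    show "\<exists>w\<in>common_nbrs E (?U a b i) R. c w"
      if "a < ?L" "b < ?L" "i \<in> {1..k}" "nbr_dense E (V - W i) (?U a b i) r q"
        "R \<subseteq> V - W i" "card R \<le> M" "\<forall>v\<in>R. c v" for a b i R
      using that c(2)[of "(a, b, i)"] by (auto simp: I2_def B2_def)
  qed (use assms in auto)
qed

end

section \<open>Common neighbourhoods in the random graph\<close>

text \<open>This replaces conditioning on the coordinates outside \<open>J\<close>: the product
  splits into parts on \<open>J\<close> and on \<open>I - J\<close>, and overwriting the former
  discards it.\<close>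

lemma Pi_pmf_resample:
  assumes "finite I" "J \<subseteq> I"
  shows "Pi_pmf I d P = bind_pmf (Pi_pmf I d P) (\<lambda>f. bind_pmf (Pi_pmf J d P)
    (\<lambda>g. return_pmf (\<lambda>x. if x \<in> J then g x else f x)))"
proof -
  have I: "I = J \<union> (I - J)" and fin: "finite J" "finite (I - J)"
    using assms finite_subset by auto
  have *: "Pi_pmf I d P = map_pmf (\<lambda>(g, f) x. if x \<in> J then g x else f x)
      (pair_pmf (Pi_pmf J d P) (Pi_pmf (I - J) d P))"
    by (subst I, subst Pi_pmf_union) (use fin in auto)
  have "bind_pmf (Pi_pmf I d P) (\<lambda>f. bind_pmf (Pi_pmf J d P)
      (\<lambda>g. return_pmf (\<lambda>x. if x \<in> J then g x else f x)))
    = bind_pmf (Pi_pmf J d P) (\<lambda>_. bind_pmf (Pi_pmf (I - J) d P) (\<lambda>f. bind_pmf (Pi_pmf J d P)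
      (\<lambda>g. return_pmf (\<lambda>x. if x \<in> J then g x else f x))))"
    by (simp add: * map_pmf_def pair_pmf_def bind_assoc_pmf bind_return_pmf cong: if_cong)
  also have "\<dots> = bind_pmf (Pi_pmf (I - J) d P) (\<lambda>f. bind_pmf (Pi_pmf J d P)
      (\<lambda>g. return_pmf (\<lambda>x. if x \<in> J then g x else f x)))"
    by simp
  also have "\<dots> = bind_pmf (Pi_pmf J d P) (\<lambda>g. bind_pmf (Pi_pmf (I - J) d P)
      (\<lambda>f. return_pmf (\<lambda>x. if x \<in> J then g x else f x)))"
    by (rule bind_commute_pmf)
  also have "\<dots> = Pi_pmf I d P"
    by (simp add: * map_pmf_def pair_pmf_def bind_assoc_pmf bind_return_pmf)
  finally show ?thesis by simp
qed

lemma finite_set_Pi_pmf_bernoulli: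
  "finite I \<Longrightarrow> finite (set_pmf (Pi_pmf I False (\<lambda>_. bernoulli_pmf p)))"
  by (rule finite_subset[OF set_Pi_pmf_subset']) auto

text \<open>One step of a chain rule. \<open>F\<close> describes the past and ignores
  \<open>J\<close>; over fresh values on \<open>J\<close>, \<open>G\<close> averages to at most
  \<open>x\<close>, which is asked only where \<open>F\<close> does not vanish.\<close>

lemma expectation_resample_le:
  fixes F G :: "('i \<Rightarrow> bool) \<Rightarrow> real"
  assumes I: "finite I" "J \<subseteq> I" and F: "\<And>f. 0 \<le> F f"
    and FJ: "\<And>f g. F (\<lambda>e. if e \<in> J then g e else f e) = F f"
    and G: "\<And>f. F f \<noteq> 0 \<Longrightarrow> measure_pmf.expectation (Pi_pmf J False (\<lambda>_. bernoulli_pmf p))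
      (\<lambda>g. G (\<lambda>e. if e \<in> J then g e else f e)) \<le> x"
  shows "measure_pmf.expectation (Pi_pmf I False (\<lambda>_. bernoulli_pmf p)) (\<lambda>f. F f * G f)
    \<le> x * measure_pmf.expectation (Pi_pmf I False (\<lambda>_. bernoulli_pmf p)) F"
proof -
  let ?Q = "\<lambda>I. Pi_pmf I False (\<lambda>_. bernoulli_pmf p)"
  let ?m = "\<lambda>f g e. if e \<in> J then g e else f e"
  let ?A = "set_pmf (?Q I)"
  have fin: "finite ?A" "finite (set_pmf (?Q J))"
    using I finite_set_Pi_pmf_bernoulli finite_subset by metis+
  have "measure_pmf.expectation (?Q I) (\<lambda>f. F f * G f) =
      measure_pmf.expectation (bind_pmf (?Q I) (\<lambda>f. map_pmf (?m f) (?Q J))) (\<lambda>f. F f * G f)"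
    by (subst Pi_pmf_resample[OF I]) (simp add: map_pmf_def)
  also have "\<dots> = (\<Sum>f\<in>?A. pmf (?Q I) f *\<^sub>R
      measure_pmf.expectation (map_pmf (?m f) (?Q J)) (\<lambda>f. F f * G f))"
    using fin by (intro pmf_expectation_bind) auto
  also have "\<dots> = (\<Sum>f\<in>?A. pmf (?Q I) f * (F f * measure_pmf.expectation (?Q J) (\<lambda>g. G (?m f g))))"
    by (simp add: FJ)
  also have "\<dots> \<le> (\<Sum>f\<in>?A. pmf (?Q I) f * (F f * x))"
  proof (rule sum_mono, rule mult_left_mono)
    fix f
    show "F f * measure_pmf.expectation (?Q J) (\<lambda>g. G (?m f g)) \<le> F f * x"
      using F[of f] G[of f] by (cases "F f = 0") (auto intro: mult_left_mono)
  qed simp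
  also have "\<dots> = x * (\<Sum>f\<in>?A. pmf (?Q I) f * F f)"
    by (simp add: sum_distrib_left algebra_simps)
  also have "(\<Sum>f\<in>?A. pmf (?Q I) f * F f) = measure_pmf.expectation (?Q I) F"
    using fin by (subst integral_measure_pmf[of ?A]) auto
  finally show ?thesis .
qed

text \<open>The vertices of \<open>U\<close> use disjoint sets of pairs, and each is a common
  neighbour of \<open>D\<close> with probability \<open>p ^ card D\<close>. So the Laplace transform
  factors, one vertex at a time.\<close>

lemma expectation_exp_common_le:
  fixes p :: real
  assumes p: "0 \<le> p" "p \<le> 1" and fin: "finite I" "finite D" "finite U" "D \<inter> U = {}"
    and I: "\<And>u w. u \<in> D \<Longrightarrow> w \<in> U \<Longrightarrow> {u, w} \<in> I"
  shows "measure_pmf.expectation (Pi_pmf I False (\<lambda>_. bernoulli_pmf p))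
      (\<lambda>f. exp (- real (card {w \<in> U. \<forall>u\<in>D. f {u, w}}))) \<le> exp (- (p ^ card D / 2)) ^ card U"
  using fin(3,4) I
proof (induction U rule: finite_induct)
  case empty
  then show ?case by simp
next
  case (insert w U)
  let ?Q = "\<lambda>I. Pi_pmf I False (\<lambda>_. bernoulli_pmf p)"
  define J where "J = (\<lambda>u. {u, w}) ` D"
  define F where "F = (\<lambda>f. exp (- real (card {w \<in> U. \<forall>u\<in>D. f {u, w}})))"
  define G :: "('a set \<Rightarrow> bool) \<Rightarrow> real" where "G = (\<lambda>f. if \<forall>u\<in>D. f {u, w} then exp (- 1) else 1)"
  have J: "J \<subseteq> I" "finite J" using insert.prems fin(2) by (auto simp: J_def)
  have "inj_on (\<lambda>u. {u, w}) D" using insert.prems by (auto simp: inj_on_def doubleton_eq_iff)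
  then have cardJ: "card J = card D" by (simp add: J_def card_image)
  have "exp (- real (card {v \<in> insert w U. \<forall>u\<in>D. f {u, v}})) = F f * G f" for f
  proof -
    have "{v \<in> insert w U. \<forall>u\<in>D. f {u, v}} = (if \<forall>u\<in>D. f {u, w}
        then insert w {v \<in> U. \<forall>u\<in>D. f {u, v}} else {v \<in> U. \<forall>u\<in>D. f {u, v}})" by auto
    then show ?thesis
      using insert.hyps by (simp add: F_def G_def exp_add[symmetric] exp_diff exp_minus field_simps)
  qed
  then have "measure_pmf.expectation (?Q I) (\<lambda>f. exp (- real (card {v \<in> insert w U. \<forall>u\<in>D. f {u, v}})))
      = measure_pmf.expectation (?Q I) (\<lambda>f. F f * G f)" by simp
  also have "\<dots> \<le> exp (- (p ^ card D / 2)) * measure_pmf.expectation (?Q I) F"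
  proof (rule expectation_resample_le[OF fin(1) J(1)])
    show "0 \<le> F f" for f by (simp add: F_def)
    have "{u, v} \<notin> J" if "u \<in> D" "v \<in> U" for u v
      using that insert.hyps insert.prems by (auto simp: J_def doubleton_eq_iff)
    then show "F (\<lambda>e. if e \<in> J then g e else f e) = F f" for f g
      by (simp add: F_def cong: conj_cong)
    fix f
    let ?B = "{g. \<forall>e\<in>J. g e = True}"
    have "(\<lambda>g. G (\<lambda>e. if e \<in> J then g e else f e)) = (\<lambda>g. 1 - (1 - exp (- 1)) * indicator ?B g)"
      by (auto simp: G_def J_def indicator_def fun_eq_iff)
    moreover have "finite (set_pmf (?Q J))" using J(2) by (rule finite_set_Pi_pmf_bernoulli)
    ultimately have "measure_pmf.expectation (?Q J) (\<lambda>g. G (\<lambda>e. if e \<in> J then g e else f e))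
        = 1 - (1 - exp (- 1)) * measure_pmf.prob (?Q J) ?B"
      by (simp add: Bochner_Integration.integral_diff integrable_measure_pmf_finite)
    also have "\<dots> = 1 - (1 - exp (- 1)) * p ^ card D"
      using prob_coins_const[OF J(2) order.refl p, of True] cardJ by simp
    \<comment> \<open>\<open>exp 1 \<ge> 2\<close> turns the factor \<open>1 - exp (- 1)\<close>
      into 1/2.\<close>
    also have "\<dots> \<le> 1 - p ^ card D / 2"
    proof -
      have "(1::real) / 2 \<le> 1 - exp (- 1)"
        using exp_ge_add_one_self[of "1::real"] by (simp add: exp_minus field_simps)
      then have "1 / 2 * p ^ card D \<le> (1 - exp (- 1)) * p ^ card D"
        using p by (intro mult_right_mono) auto
      then show ?thesis by simp
    qed
    also have "\<dots> \<le> exp (- (p ^ card D / 2))"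
      using exp_ge_add_one_self[of "- (p ^ card D / 2)"] by simp
    finally show "measure_pmf.expectation (?Q J) (\<lambda>g. G (\<lambda>e. if e \<in> J then g e else f e))
      \<le> exp (- (p ^ card D / 2))" .
  qed
  also have "\<dots> \<le> exp (- (p ^ card D / 2)) * exp (- (p ^ card D / 2)) ^ card U"
    using insert by (intro mult_left_mono) (auto simp: F_def)
  finally show ?case using insert.hyps by simp
qed

text \<open>Exponential Markov inequality with parameter 1 for the lower tail.\<close>

lemma prob_few_common:
  fixes p a :: real
  assumes p: "0 \<le> p" "p \<le> 1" and fin: "finite I" "finite D" "finite U" "D \<inter> U = {}"
    and I: "\<And>u w. u \<in> D \<Longrightarrow> w \<in> U \<Longrightarrow> {u, w} \<in> I"
  shows "measure_pmf.prob (Pi_pmf I False (\<lambda>_. bernoulli_pmf p))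
      {f. real (card {w \<in> U. \<forall>u\<in>D. f {u, w}}) < a} \<le> exp (a - p ^ card D * real (card U) / 2)"
proof -
  let ?Q = "Pi_pmf I False (\<lambda>_. bernoulli_pmf p)"
  let ?X = "\<lambda>f. real (card {w \<in> U. \<forall>u\<in>D. f {u, w}})"
  have fin': "finite (set_pmf ?Q)" using fin(1) by (rule finite_set_Pi_pmf_bernoulli)
  have "measure_pmf.prob ?Q {f. ?X f < a} = measure_pmf.expectation ?Q (indicator {f. ?X f < a})"
    by simp
  also have "\<dots> \<le> measure_pmf.expectation ?Q (\<lambda>f. exp a * exp (- ?X f))"
    using fin' by (intro integral_mono integrable_measure_pmf_finite)
      (auto simp: indicator_def exp_add[symmetric])
  also have "\<dots> = exp a * measure_pmf.expectation ?Q (\<lambda>f. exp (- ?X f))" by simp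
  also have "\<dots> \<le> exp a * exp (- (p ^ card D / 2)) ^ card U"
    using assms by (intro mult_left_mono expectation_exp_common_le) auto
  also have "\<dots> = exp (a - p ^ card D * real (card U) / 2)"
    by (simp add: exp_of_nat_mult[symmetric] exp_add[symmetric] algebra_simps)
  finally show ?thesis .
qed

section \<open>Families of sets that lose common neighbours\<close>

fun loses :: "'a set set \<Rightarrow> 'a set \<Rightarrow> real \<Rightarrow> real \<Rightarrow> 'a set list \<Rightarrow> bool" where
  "loses E U q q' [] \<longleftrightarrow> True"
| "loses E U q q' (R # Rs) \<longleftrightarrow> loses E U q q' Rs \<and>
    q \<le> real (card (common_nbrs E U (R \<inter> \<Union>(set Rs)))) \<and> real (card (common_nbrs E U R)) < q'"

lemma common_nbrs_cong:
  "(\<And>u w. u \<in> R \<Longrightarrow> w \<in> U \<Longrightarrow> {u, w} \<in> E \<longleftrightarrow> {u, w} \<in> E') \<Longrightarrow>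
    common_nbrs E U R = common_nbrs E' U R"
  by (auto simp: common_nbrs_def)

lemma loses_cong:
  "(\<And>u w. u \<in> \<Union>(set Rs) \<Longrightarrow> w \<in> U \<Longrightarrow> {u, w} \<in> E \<longleftrightarrow> {u, w} \<in> E') \<Longrightarrow>
    loses E U q q' Rs = loses E' U q q' Rs"
proof (induction Rs)
  case (Cons R Rs)
  then have "common_nbrs E U (R \<inter> \<Union>(set Rs)) = common_nbrs E' U (R \<inter> \<Union>(set Rs))"
    "common_nbrs E U R = common_nbrs E' U R"
    by (intro common_nbrs_cong; simp)+
  with Cons show ?case by simp
qed simp

text \<open>The head of the list is the newest set \<open>R\<close>. The pairs at earlier sets fix
  the common neighbours of its overlap with them, at least \<open>q\<close> many. The pairs between
  the new vertices \<open>D\<close> and \<open>U\<close> are still fresh, so a drop below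
  \<open>q'\<close> costs a factor \<open>exp (q' - \<rho> * q / 2)\<close>.\<close>

lemma prob_loses:
  fixes p q q' \<rho> :: real
  assumes p: "0 \<le> p" "p \<le> 1" and V: "finite V" "U \<subseteq> V" and "0 \<le> q" "0 \<le> \<rho>"
    and Rs: "\<And>R. R \<in> set Rs \<Longrightarrow> R \<subseteq> V - U \<and> \<rho> \<le> p ^ card R"
  shows "measure_pmf.prob (Pi_pmf (pairs V) False (\<lambda>_. bernoulli_pmf p))
    {f. loses {e \<in> pairs V. f e} U q q' Rs} \<le> exp (q' - \<rho> * q / 2) ^ length Rs"
  using Rs
proof (induction Rs)
  case Nil
  then show ?case by simp
next
  case (Cons R Rs)
  let ?I = "pairs V"
  let ?Q = "\<lambda>I. Pi_pmf I False (\<lambda>_. bernoulli_pmf p)"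
  let ?E = "\<lambda>f. {e \<in> ?I. f e}"
  let ?T = "\<Union>(set Rs)"
  let ?x = "exp (q' - \<rho> * q / 2)"
  define D where "D = R - ?T"
  define J where "J = (\<lambda>(u, w). {u, w}) ` (D \<times> U)"
  define F :: "('a set \<Rightarrow> bool) \<Rightarrow> real" where
    "F = indicator {f. loses (?E f) U q q' Rs \<and> q \<le> real (card (common_nbrs (?E f) U (R \<inter> ?T)))}"
  define G :: "('a set \<Rightarrow> bool) \<Rightarrow> real" where
    "G = indicator {f. real (card (common_nbrs (?E f) U R)) < q'}"
  have finI: "finite ?I" using V(1) by (auto simp: pairs_def intro: finite_subset[of _ "Pow V"])
  have T: "?T \<subseteq> V - U" using Cons.prems by auto
  have R: "R \<subseteq> V - U" "\<rho> \<le> p ^ card R" using Cons.prems by auto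
  have finR: "finite R" "finite U" using R V finite_subset by blast+
  have pairs: "{u, w} \<in> ?I" if "u \<in> V - U" "w \<in> U" for u w
    using that V by (auto simp: pairs_def card_2_iff)
  have J: "J \<subseteq> ?I" "finite J" using pairs R finR by (auto simp: J_def D_def)
  have notJ: "{u, w} \<notin> J" if "u \<in> ?T" "w \<in> U" for u w
    using that R T by (auto simp: J_def D_def doubleton_eq_iff)
  have inJ: "{u, w} \<in> J" if "u \<in> D" "w \<in> U" for u w
    using that by (auto simp: J_def)
  have "measure_pmf.prob (?Q ?I) {f. loses (?E f) U q q' (R # Rs)} =
      measure_pmf.expectation (?Q ?I) (indicator {f. loses (?E f) U q q' (R # Rs)})" by simp
  also have "indicator {f. loses (?E f) U q q' (R # Rs)} = (\<lambda>f. F f * G f)"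
    by (auto simp: F_def G_def indicator_def fun_eq_iff)
  also have "measure_pmf.expectation (?Q ?I) (\<lambda>f. F f * G f) \<le> ?x * measure_pmf.expectation (?Q ?I) F"
  proof (rule expectation_resample_le[OF finI J(1)])
    show "0 \<le> F f" for f by (simp add: F_def)
    fix f g :: "'a set \<Rightarrow> bool"
    let ?m = "\<lambda>e. if e \<in> J then g e else f e"
    have "loses (?E ?m) U q q' Rs = loses (?E f) U q q' Rs"
      using notJ by (intro loses_cong) auto
    moreover have "common_nbrs (?E ?m) U (R \<inter> ?T) = common_nbrs (?E f) U (R \<inter> ?T)"
      using notJ by (intro common_nbrs_cong) auto
    ultimately show "F ?m = F f" by (simp add: F_def indicator_def)
  next
    fix f assume "F f \<noteq> 0"
    then have q: "q \<le> real (card (common_nbrs (?E f) U (R \<inter> ?T)))"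
      by (auto simp: F_def indicator_def split: if_splits)
    let ?m = "\<lambda>g e. if e \<in> J then g e else f e"
    \<comment> \<open>Determined by pairs outside \<open>J\<close>, hence unaffected by redrawing
      \<open>J\<close>.\<close>
    define U' where "U' = common_nbrs (?E f) U (R \<inter> ?T)"
    have U': "U' \<subseteq> U" by (auto simp: U'_def common_nbrs_def)
    have eq: "common_nbrs (?E (?m g)) U R = {w \<in> U'. \<forall>u\<in>D. g {u, w}}" for g
    proof -
      have "common_nbrs (?E (?m g)) U R =
        {w \<in> common_nbrs (?E (?m g)) U (R \<inter> ?T). \<forall>u\<in>D. {u, w} \<in> ?E (?m g)}"
        by (auto simp: common_nbrs_def D_def)
      also have "common_nbrs (?E (?m g)) U (R \<inter> ?T) = U'"
        unfolding U'_def using notJ by (intro common_nbrs_cong) auto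
      also have "{w \<in> U'. \<forall>u\<in>D. {u, w} \<in> ?E (?m g)} = {w \<in> U'. \<forall>u\<in>D. g {u, w}}"
        using inJ J(1) U' by auto
      finally show ?thesis .
    qed
    have "(\<lambda>g. G (?m g)) = indicator {g. real (card {w \<in> U'. \<forall>u\<in>D. g {u, w}}) < q'}"
      by (simp add: G_def indicator_def eq fun_eq_iff)
    then have "measure_pmf.expectation (?Q J) (\<lambda>g. G (?m g)) = measure_pmf.prob (?Q J) {g. real (card {w \<in> U'. \<forall>u\<in>D. g {u, w}}) < q'}" by simp
    also have "\<dots> \<le> exp (q' - p ^ card D * real (card U') / 2)"
      using U' J(2) finR inJ R finite_subset[OF U'] by (intro prob_few_common p) (auto simp: D_def)
    also have "\<dots> \<le> ?x"
    proof -
      have "card D \<le> card R" unfolding D_def using finR by (intro card_mono) auto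
      then have "p ^ card R \<le> p ^ card D" using p by (intro power_decreasing) auto
      then have "\<rho> * q \<le> p ^ card D * real (card U')"
        using R(2) q assms(5,6) by (intro mult_mono) (auto simp: U'_def)
      then show ?thesis by simp
    qed
    finally show "measure_pmf.expectation (?Q J) (\<lambda>g. G (?m g)) \<le> ?x" .
  qed
  also have "measure_pmf.expectation (?Q ?I) F \<le> measure_pmf.prob (?Q ?I) {f. loses (?E f) U q q' Rs}"
    unfolding F_def by (auto intro: measure_pmf.finite_measure_mono)
  also have "\<dots> \<le> ?x ^ length Rs" using Cons by simp
  finally show ?case by simp
qed

text \<open>
  As long as the sets chosen so far do not meet every deficient set in \<open>r\<close> points, one more
  deficient set can be added; density controls its overlap with the previous ones.
\<close>

lemma greedy_loses:
  assumes "finite X" "nbr_dense E X U r q"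
    and step: "\<And>S. S \<subseteq> X \<Longrightarrow> card S \<le> m * M \<Longrightarrow>
      \<exists>R. R \<subseteq> X \<and> card R \<le> M \<and> real (card (common_nbrs E U R)) < q' \<and> card (R \<inter> S) < r"
  shows "j \<le> m \<Longrightarrow> \<exists>Rs. length Rs = j \<and> (\<forall>R\<in>set Rs. R \<subseteq> X \<and> card R \<le> M) \<and>
    card (\<Union>(set Rs)) \<le> j * M \<and> loses E U q q' Rs"
proof (induction j)
  case 0
  then show ?case by simp
next
  case (Suc j)
  then obtain Rs where Rs: "length Rs = j" "\<forall>R\<in>set Rs. R \<subseteq> X \<and> card R \<le> M"
    "card (\<Union>(set Rs)) \<le> j * M" "loses E U q q' Rs" by auto
  have "j * M \<le> m * M" using Suc.prems by simp
  then have "card (\<Union>(set Rs)) \<le> m * M" using Rs(3) by linarith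
  moreover have "\<Union>(set Rs) \<subseteq> X" using Rs(2) by blast
  ultimately obtain R where R: "R \<subseteq> X" "card R \<le> M" "real (card (common_nbrs E U R)) < q'"
    "card (R \<inter> \<Union>(set Rs)) < r"
    using step by blast
  have "q \<le> real (card (common_nbrs E U (R \<inter> \<Union>(set Rs))))"
    using assms(2) R unfolding nbr_dense_def by (metis Int_lower1 less_imp_le order_trans)
  moreover have "card (\<Union>(set (R # Rs))) \<le> Suc j * M"
    using card_Un_le[of R "\<Union>(set Rs)"] R(2) Rs(3) by simp
  ultimately show ?case using R Rs by (intro exI[of _ "R # Rs"]) auto
qed

text \<open>\<open>S\<close> may depend on \<open>U\<close> but not on \<open>R\<close>: all
  failures are concentrated in one small place.\<close>

definition mostly_dense :: "'a set set \<Rightarrow> 'a set \<Rightarrow> 'a set \<Rightarrow> nat \<Rightarrow> nat \<Rightarrow> nat \<Rightarrow> real \<Rightarrow> bool" where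
  "mostly_dense E X U s M r q' \<longleftrightarrow> (\<exists>S\<subseteq>X. card S \<le> s \<and>
     (\<forall>R. R \<subseteq> X \<and> card R \<le> M \<and> real (card (common_nbrs E U R)) < q' \<longrightarrow> r \<le> card (R \<inter> S)))"

text \<open>If no \<open>S\<close> of size at most \<open>m * M\<close> works,
  \<open>greedy_loses\<close> yields \<open>m\<close> losing sets, with the union of the previous
  ones tried as \<open>S\<close>. In the union bound each set pays for its own choice, and a large
  \<open>m\<close> pays for the \<open>2 ^ card B\<close> choices of \<open>U\<close>.\<close>

lemma prob_dense_not_mostly_dense:
  fixes p q q' \<rho> :: real
  assumes p: "0 \<le> p" "p \<le> 1" and V: "finite V" "B \<subseteq> V" and "0 \<le> q" "0 \<le> \<rho>" "\<rho> \<le> p ^ M"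
  shows "measure_pmf.prob (erdos_renyi V p)
      {E. \<exists>U\<subseteq>B. nbr_dense E (V - B) U r q \<and> \<not> mostly_dense E (V - B) U (m * M) M r q'}
    \<le> 2 ^ card B * (real ((card V + 1) ^ M) * exp (q' - \<rho> * q / 2)) ^ m"
proof -
  let ?Q = "Pi_pmf (pairs V) False (\<lambda>_. bernoulli_pmf p)"
  let ?E = "\<lambda>f. {e \<in> pairs V. f e}"
  let ?S = "{R. R \<subseteq> V - B \<and> card R \<le> M}"
  let ?L = "{Rs. set Rs \<subseteq> ?S \<and> length Rs = m}"
  let ?x = "exp (q' - \<rho> * q / 2)"
  have finS: "finite ?S" using V(1) by (auto intro: finite_subset[of _ "Pow V"])
  have finB: "finite B" using V finite_subset by blast
  have finL: "finite ?L" by (rule finite_lists_length_eq[OF finS])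
  have sub: "{f. \<exists>U\<subseteq>B. nbr_dense (?E f) (V - B) U r q \<and> \<not> mostly_dense (?E f) (V - B) U (m * M) M r q'}
    \<subseteq> (\<Union>(U, Rs)\<in>Pow B \<times> ?L. {f. loses (?E f) U q q' Rs})"
  proof
    fix f
    assume "f \<in> {f. \<exists>U\<subseteq>B. nbr_dense (?E f) (V - B) U r q \<and>
      \<not> mostly_dense (?E f) (V - B) U (m * M) M r q'}"
    then obtain U where U: "U \<subseteq> B" "nbr_dense (?E f) (V - B) U r q"
      "\<not> mostly_dense (?E f) (V - B) U (m * M) M r q'" by blast
    have "\<exists>Rs. length Rs = m \<and> (\<forall>R\<in>set Rs. R \<subseteq> V - B \<and> card R \<le> M) \<and>
        card (\<Union>(set Rs)) \<le> m * M \<and> loses (?E f) U q q' Rs"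
    proof (rule greedy_loses[OF _ U(2)])
      fix S assume "S \<subseteq> V - B" "card S \<le> m * M"
      with U(3) show "\<exists>R. R \<subseteq> V - B \<and> card R \<le> M \<and> real (card (common_nbrs (?E f) U R)) < q' \<and>
        card (R \<inter> S) < r" unfolding mostly_dense_def by (meson not_le)
    qed (use V in auto)
    then obtain Rs where Rs: "length Rs = m" "\<forall>R\<in>set Rs. R \<subseteq> V - B \<and> card R \<le> M"
      "loses (?E f) U q q' Rs" by blast
    then have "(U, Rs) \<in> Pow B \<times> ?L" using U(1) by auto
    with Rs(3) show "f \<in> (\<Union>(U, Rs)\<in>Pow B \<times> ?L. {f. loses (?E f) U q q' Rs})" by blast
  qed
  have "measure_pmf.prob (erdos_renyi V p)
      {E. \<exists>U\<subseteq>B. nbr_dense E (V - B) U r q \<and> \<not> mostly_dense E (V - B) U (m * M) M r q'}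
    = measure_pmf.prob ?Q
      {f. \<exists>U\<subseteq>B. nbr_dense (?E f) (V - B) U r q \<and> \<not> mostly_dense (?E f) (V - B) U (m * M) M r q'}"
    by (simp add: erdos_renyi_def vimage_def)
  also have "\<dots> \<le> measure_pmf.prob ?Q (\<Union>(U, Rs)\<in>Pow B \<times> ?L. {f. loses (?E f) U q q' Rs})"
    using sub by (intro measure_pmf.finite_measure_mono) auto
  also have "\<dots> \<le> (\<Sum>z\<in>Pow B \<times> ?L. measure_pmf.prob ?Q (case z of (U, Rs) \<Rightarrow> {f. loses (?E f) U q q' Rs}))"
    using finB finL by (intro measure_UNION_le) auto
  also have "\<dots> \<le> (\<Sum>z\<in>Pow B \<times> ?L. ?x ^ m)"
  proof (rule sum_mono)
    fix z assume "z \<in> Pow B \<times> ?L"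
    then obtain U Rs where z: "z = (U, Rs)" "U \<subseteq> B" "set Rs \<subseteq> ?S" "length Rs = m" by auto
    have "R \<subseteq> V - U \<and> \<rho> \<le> p ^ card R" if "R \<in> set Rs" for R
    proof -
      have "R \<subseteq> V - B" "card R \<le> M" using that z(3) by auto
      moreover from this have "p ^ M \<le> p ^ card R" using p by (intro power_decreasing) auto
      ultimately show ?thesis using z(2) assms(7) by auto
    qed
    then have "measure_pmf.prob ?Q {f. loses (?E f) U q q' Rs} \<le> ?x ^ length Rs"
      using z(2) V(2) assms(5,6) by (intro prob_loses p V(1)) auto
    then show "measure_pmf.prob ?Q (case z of (U, Rs) \<Rightarrow> {f. loses (?E f) U q q' Rs}) \<le> ?x ^ m"
      using z by simp
  qed
  also have "\<dots> = real (card (Pow B \<times> ?L)) * ?x ^ m" by simp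
  also have "card (Pow B \<times> ?L) = 2 ^ card B * card ?S ^ m"
    using card_lists_length_eq[OF finS] finB by (simp add: card_cartesian_product card_Pow)
  also have "real (2 ^ card B * card ?S ^ m) * ?x ^ m = 2 ^ card B * (real (card ?S) * ?x) ^ m"
    by (simp add: power_mult_distrib)
  also have "\<dots> \<le> 2 ^ card B * (real ((card V + 1) ^ M) * ?x) ^ m"
  proof (intro mult_left_mono power_mono mult_right_mono)
    have "finite {R. R \<subseteq> V \<and> card R \<le> M}"
      by (rule finite_subset[of _ "Pow V"]) (use V(1) in auto)
    then have "card ?S \<le> card {R. R \<subseteq> V \<and> card R \<le> M}" by (intro card_mono) auto
    also have "\<dots> \<le> (card V + 1) ^ M" by (rule card_bounded_subsets[OF V(1)])
    finally show "real (card ?S) \<le> real ((card V + 1) ^ M)" by linarith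
  qed auto
  finally show ?thesis .
qed

text \<open>Union bound over \<open>R\<close> of the lower tail \<open>prob_few_common\<close>, with
  the whole block as \<open>U\<close>.\<close>

lemma prob_block_not_dense:
  fixes p a \<rho> :: real
  assumes p: "0 \<le> p" "p \<le> 1" and V: "finite V" "B \<subseteq> V" and "0 \<le> \<rho>" "\<rho> \<le> p ^ M"
  shows "measure_pmf.prob (erdos_renyi V p) {E. \<not> nbr_dense E (V - B) B M a}
    \<le> real ((card V + 1) ^ M) * exp (a - \<rho> * card B / 2)"
proof -
  let ?Q = "Pi_pmf (pairs V) False (\<lambda>_. bernoulli_pmf p)"
  let ?E = "\<lambda>f. {e \<in> pairs V. f e}"
  let ?S = "{R. R \<subseteq> V - B \<and> card R \<le> M}"
  have finS: "finite ?S" using V(1) by (auto intro: finite_subset[of _ "Pow V"])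
  have finI: "finite (pairs V)" using V(1) by (auto simp: pairs_def intro: finite_subset[of _ "Pow V"])
  have "measure_pmf.prob (erdos_renyi V p) {E. \<not> nbr_dense E (V - B) B M a}
    = measure_pmf.prob ?Q {f. \<not> nbr_dense (?E f) (V - B) B M a}"
    by (simp add: erdos_renyi_def vimage_def)
  also have "\<dots> \<le> measure_pmf.prob ?Q (\<Union>R\<in>?S. {f. real (card (common_nbrs (?E f) B R)) < a})"
    by (intro measure_pmf.finite_measure_mono) (auto simp: nbr_dense_def not_le)
  also have "\<dots> \<le> (\<Sum>R\<in>?S. measure_pmf.prob ?Q {f. real (card (common_nbrs (?E f) B R)) < a})"
    using finS by (intro measure_UNION_le) auto
  also have "\<dots> \<le> (\<Sum>R\<in>?S. exp (a - \<rho> * card B / 2))"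
  proof (rule sum_mono)
    fix R assume R: "R \<in> ?S"
    have pairs: "{u, w} \<in> pairs V" if "u \<in> R" "w \<in> B" for u w
    proof -
      have "u \<in> V" "w \<in> V" "u \<noteq> w" using that V R by auto
      then show ?thesis by (simp add: pairs_def)
    qed
    then have "common_nbrs (?E f) B R = {w \<in> B. \<forall>u\<in>R. f {u, w}}" for f
      by (auto simp: common_nbrs_def)
    then have "measure_pmf.prob ?Q {f. real (card (common_nbrs (?E f) B R)) < a} =
      measure_pmf.prob ?Q {f. real (card {w \<in> B. \<forall>u\<in>R. f {u, w}}) < a}" by simp
    also have "\<dots> \<le> exp (a - p ^ card R * real (card B) / 2)"
      using R V finite_subset pairs by (intro prob_few_common p finI) blast+
    also have "\<dots> \<le> exp (a - \<rho> * card B / 2)"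
    proof -
      have "p ^ M \<le> p ^ card R" using p R by (intro power_decreasing) auto
      then have "\<rho> * card B \<le> p ^ card R * card B" using assms(6) by (intro mult_right_mono) auto
      then show ?thesis by simp
    qed
    finally show "measure_pmf.prob ?Q {f. real (card (common_nbrs (?E f) B R)) < a}
      \<le> exp (a - \<rho> * card B / 2)" .
  qed
  also have "\<dots> = real (card ?S) * exp (a - \<rho> * card B / 2)" by simp
  also have "\<dots> \<le> real ((card V + 1) ^ M) * exp (a - \<rho> * card B / 2)"
  proof (rule mult_right_mono)
    have "finite {R. R \<subseteq> V \<and> card R \<le> M}"
      by (rule finite_subset[of _ "Pow V"]) (use V(1) in auto)
    then have "card ?S \<le> card {R. R \<subseteq> V \<and> card R \<le> M}" by (intro card_mono) auto
    also have "\<dots> \<le> (card V + 1) ^ M" by (rule card_bounded_subsets[OF V(1)])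
    finally show "real (card ?S) \<le> real ((card V + 1) ^ M)" by linarith
  qed simp
  finally show ?thesis .
qed

section \<open>Choice of parameters\<close>

text \<open>\<open>M\<close> is about \<open>k / (128 * \<xi>)\<close>, which keeps
  \<open>p ^ M\<close> at least \<open>n powr (-1/64)\<close>. Cutting \<open>k\<close> ones into
  pieces of \<open>M div 2\<close> takes \<open>l\<close> of order \<open>k / M\<close>, and
  distributing \<open>M\<close> over \<open>Suc l\<close> segments leaves \<open>r\<close> of order
  \<open>M\<^sup>2 / k\<close>, that is \<open>k / \<xi>\<^sup>2\<close>.\<close>

lemma parameters_exist:
  fixes \<xi> :: real and k :: nat
  assumes "\<xi> > 1" and big: "real k / \<xi>\<^sup>2 > 41943040"
  obtains M l r :: nat where "2 * \<xi> * real M / (real k - 1) \<le> 1 / 64" "1 \<le> M" "M \<le> k"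
    "k \<le> l * (M div 2)" "Suc l * r \<le> M" "M * Suc l \<le> 5 * k" "r \<le> M div 2" "6 \<le> r"
    "real k / \<xi>\<^sup>2 / 2621440 \<le> real r"
proof -
  define y where "y = real k / \<xi>\<^sup>2"
  have "\<xi>\<^sup>2 > 1" using assms(1) by (simp add: one_less_power)
  have ky: "real k = y * \<xi>\<^sup>2" using assms(1) by (simp add: y_def)
  have y: "y > 41943040" using big by (simp add: y_def)
  then have "y * \<xi> \<ge> y" using assms(1) by simp
  have kxi: "real k / \<xi> = y * \<xi>" using assms(1) by (simp add: ky power2_eq_square)
  have "y * \<xi>\<^sup>2 \<ge> y" using y \<open>\<xi>\<^sup>2 > 1\<close> by simp
  then have k: "real k > 41943040" using y ky by linarith
  define M where "M = nat \<lfloor>(real k - 1) / (128 * \<xi>)\<rfloor>"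
  have nonneg: "0 \<le> (real k - 1) / (128 * \<xi>)" using k assms(1) by simp
  have Mle: "real M \<le> (real k - 1) / (128 * \<xi>)" using nonneg by (simp add: M_def)
  \<comment> \<open>The factor 4 between 128 and 512 absorbs \<open>k - 1\<close> and the
    rounding.\<close>
  have Mge: "real M \<ge> real k / (512 * \<xi>)"
  proof -
    have "(real k - 1) / (128 * \<xi>) \<ge> (real k / 2) / (128 * \<xi>)"
      using k assms(1) by (intro divide_right_mono) auto
    moreover have "real M > (real k - 1) / (128 * \<xi>) - 1" using nonneg unfolding M_def by linarith
    moreover have "real k / \<xi> \<ge> 512" using kxi \<open>y * \<xi> \<ge> y\<close> y by linarith
    moreover have "(real k / 2) / (128 * \<xi>) = (real k / \<xi>) / 256" by simp
    moreover have "real k / (512 * \<xi>) = (real k / \<xi>) / 512" by simp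
    ultimately show ?thesis by linarith
  qed
  have M2: "M \<ge> 2"
  proof -
    have "real k / (512 * \<xi>) = (real k / \<xi>) / 512" by simp
    then have "real M \<ge> 2" using Mge kxi \<open>y * \<xi> \<ge> y\<close> y by linarith
    then show ?thesis by linarith
  qed
  have Mk: "M \<le> k"
  proof -
    have "(real k - 1) / (128 * \<xi>) \<le> (real k - 1) / 1"
      using k assms(1) by (intro divide_left_mono) auto
    then have "real M \<le> real k" using Mle by simp
    then show ?thesis by simp
  qed
  define T where "T = M div 2"
  have T: "1 \<le> T" "M \<le> 3 * T" using M2 by (auto simp: T_def)
  define l where "l = k div T + 1"
  have kl: "k \<le> l * T"
  proof -
    have "k mod T < T" using T(1) by simp
    moreover have "k = k div T * T + k mod T" by simp
    moreover have "l * T = k div T * T + T" by (simp add: l_def)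
    ultimately show ?thesis by linarith
  qed
  have Mt: "M * Suc l \<le> 5 * k"
  proof -
    have "T * (k div T) \<le> k" by simp
    moreover have "M * (k div T) \<le> (3 * T) * (k div T)" using T(2) by (intro mult_right_mono) auto
    ultimately have "M * (k div T) \<le> 3 * k" by linarith
    then show ?thesis using Mk by (simp add: l_def algebra_simps)
  qed
  define r where "r = M div Suc l"
  have rM: "Suc l * r \<le> M" unfolding r_def by (rule times_div_less_eq_dividend)
  have "2 * r \<le> Suc l * r" by (intro mult_right_mono) (auto simp: l_def)
  then have rT: "r \<le> M div 2" using rM by linarith
  \<comment> \<open>From \<open>M\<^sup>2 \<le> 5 * k * (r + 1)\<close> and
    \<open>512\<^sup>2 = 262144\<close> follows \<open>y \<le> 1310720 * (r + 1)\<close>; as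
    \<open>y\<close> is large, doubling the constant removes the \<open>+ 1\<close>.\<close>
  have "real r \<ge> y / 2621440"
  proof -
    have "M < Suc l * Suc r" using dividend_less_times_div[of "Suc l" M] by (simp add: r_def)
    then have "M * M \<le> M * (Suc l * Suc r)" by (intro mult_left_mono) auto
    also have "\<dots> = (M * Suc l) * Suc r" by (simp only: mult.assoc)
    also have "\<dots> \<le> (5 * k) * Suc r" using Mt by (intro mult_right_mono) auto
    finally have MM: "real M * real M \<le> 5 * real k * (real r + 1)"
      by (metis of_nat_Suc of_nat_le_iff of_nat_mult of_nat_numeral add.commute)
    have "(real k / (512 * \<xi>)) * (real k / (512 * \<xi>)) \<le> real M * real M"
      using Mge assms(1) by (intro mult_mono) auto
    also note MM
    finally have "real k * (y / 262144) \<le> real k * (5 * (real r + 1))"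
      using assms(1) by (simp add: y_def power2_eq_square field_simps)
    then have "y / 262144 \<le> 5 * (real r + 1)" by (rule mult_left_le_imp_le) (use k in simp)
    then have "y \<le> 1310720 * real r + 1310720" by simp
    then have "y \<le> 2621440 * real r" using y by linarith
    then show ?thesis by simp
  qed
  moreover from this have "6 \<le> r" using y by linarith
  moreover have "2 * \<xi> * real M / (real k - 1) \<le> 1 / 64"
  proof -
    have "real M * (128 * \<xi>) \<le> real k - 1" using Mle assms(1) by (simp add: pos_le_divide_eq)
    then show ?thesis using k by (simp add: field_simps)
  qed
  ultimately show thesis
    using that[of M l r] M2 Mk kl Mt rM rT by (simp add: y_def T_def)
qed

section \<open>Block sizes and inequalities for large n\<close>

lemma balanced_partition_card:
  assumes "balanced_partition V k W" "finite V" "i \<in> {1..k}"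
  shows "card V \<le> k * (card (W i) + 1)" "k * card (W i) \<le> card V + k"
proof -
  have fin: "finite (W j)" if "j \<in> {1..k}" for j
    using assms that UN_upper[of j "{1..k}" W] unfolding balanced_partition_def
    by (metis finite_subset)
  have "card V = (\<Sum>j\<in>{1..k}. card (W j))"
    using assms fin card_UN_disjoint[of "{1..k}" W]
    by (auto simp: balanced_partition_def disjoint_family_on_def)
  moreover have "(\<Sum>j\<in>{1..k}. card (W j)) \<le> (\<Sum>j\<in>{1..k}. card (W i) + 1)"
    using assms by (intro sum_mono) (auto simp: balanced_partition_def)
  moreover have "(\<Sum>j\<in>{1..k}. card (W i)) \<le> (\<Sum>j\<in>{1..k}. card (W j) + 1)"
    using assms by (intro sum_mono) (auto simp: balanced_partition_def)
  ultimately show "card V \<le> k * (card (W i) + 1)" "k * card (W i) \<le> card V + k"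
    by (simp_all only: sum.distrib) simp_all
qed

text \<open>The exponents come from \<open>k \<le> N powr (1/4)\<close>,
  \<open>\<rho> = N powr (-1/64)\<close>, \<open>\<delta> = N powr (-7/16)\<close> and
  \<open>card S \<le> N powr (5/16)\<close>: 47/64 is 1 - 1/64 - 1/4, 17/32 is 31/32 - 7/16 and
  33/32 is 5/16 + 31/32 - 1/4, where 31/32 belongs to \<open>\<rho>\<^sup>2 * N\<close>. The margins
  are that the first two exceed 1/2 and the last exceeds 1.\<close>

definition large :: "real \<Rightarrow> bool" where
  "large N \<longleftrightarrow> N \<ge> 1 \<and> N powr (1/16) \<ge> 2 \<and> N powr (1/8) \<ge> 3 \<and>
    sqrt N + 1 + 2 * N powr (1/4) * ln (N + 1) \<le> N powr (47/64) / 8 \<and>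
    320 * sqrt N * ln (N + 1) \<le> N powr (17/32) \<and>
    N powr (1/4) * ln (N + 1) + 2 * N + N powr (3/4) + N powr (1/4) \<le> N powr (33/32) / 640"

lemma eventually_large: "eventually (\<lambda>n::nat. large (real n)) sequentially"
  unfolding large_def by (intro eventually_conj; real_asymp)

lemma exp_ln_power: "(x::real) > 0 \<Longrightarrow> x ^ n = exp (real n * ln x)"
  by (simp add: exp_of_nat_mult)

text \<open>The spare 1 in the exponent buys the factor 1/2 with which two failure events add up to
  \<open>exp (- sqrt n)\<close>.\<close>

lemma exp_le_half:
  assumes "z \<le> - s - (1::real)"
  shows "exp z \<le> exp (- s) / 2"
proof -
  have "exp z \<le> exp (- s - 1)" using assms by simp
  also have "\<dots> = exp (- s) / exp 1" by (simp add: exp_diff)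
  also have "\<dots> \<le> exp (- s) / 2"
    using exp_ge_add_one_self[of "1::real"] by (intro divide_left_mono) auto
  finally show ?thesis .
qed

text \<open>\<open>t\<close> stands for the number \<open>Suc l\<close> from
  \<open>parameters_exist\<close>.\<close>

context
  fixes N :: real and k M t :: nat
  assumes N: "large N" and k: "1 \<le> k" "real k \<le> N powr (1/4)"
    and M: "1 \<le> M" "M \<le> k" and t: "1 \<le> t" "M * t \<le> 5 * k"
begin

lemma N_pos: "N > 0" "N \<ge> 1"
  using N by (auto simp: large_def)

lemma k_square: "real k * real k \<le> sqrt N"
proof -
  have "real k * real k \<le> N powr (1/4) * N powr (1/4)" using k by (intro mult_mono) auto
  also have "\<dots> = sqrt N" using N_pos by (simp add: powr_add[symmetric] powr_half_sqrt)
  finally show ?thesis .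
qed

lemma ln_k: "ln (real k) \<le> ln (N + 1)" "0 \<le> ln (real k)" "0 \<le> ln (N + 1)"
proof -
  have "N powr (1/4) \<le> N powr 1" using N_pos by (intro powr_mono) auto
  then show "ln (real k) \<le> ln (N + 1)" using k N_pos by simp
qed (use k N_pos in auto)

lemma kMt: "real k * real M * real t \<le> 5 * sqrt N"
proof -
  have "real (M * t) \<le> real (5 * k)" using t(2) by (simp only: of_nat_le_iff)
  then have "real k * (real M * real t) \<le> real k * (5 * real k)" by (intro mult_left_mono) auto
  also have "\<dots> \<le> 5 * sqrt N" using k_square by simp
  finally show ?thesis by (simp add: mult.assoc)
qed

lemma blocks_failure:
  "real k * ((N + 1) ^ M * exp (- (N powr (-1/64) * N / (8 * real k)))) \<le> exp (- sqrt N) / 2"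
proof -
  have "N powr (47/64) * real k \<le> N powr (47/64) * N powr (1/4)" using k by (intro mult_left_mono) auto
  also have "\<dots> = N powr (-1/64) * N"
    using N_pos powr_add[of N "-1/64" 1] by (simp add: powr_add[symmetric])
  finally have z: "N powr (47/64) / 8 \<le> N powr (-1/64) * N / (8 * real k)"
    using k by (simp add: field_simps)
  have "real M * ln (N + 1) \<le> N powr (1/4) * ln (N + 1)"
    using M k ln_k by (intro mult_right_mono) auto
  moreover have "1 * ln (N + 1) \<le> N powr (1/4) * ln (N + 1)"
    using k ln_k by (intro mult_right_mono) auto
  moreover have "sqrt N + 1 + 2 * N powr (1/4) * ln (N + 1) \<le> N powr (47/64) / 8"
    using N by (simp add: large_def)
  ultimately have "ln (real k) + (real M * ln (N + 1) + - (N powr (-1/64) * N / (8 * real k))) \<le> - sqrt N - 1"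
    using z ln_k by linarith
  then have "exp (ln (real k) + (real M * ln (N + 1) + - (N powr (-1/64) * N / (8 * real k)))) \<le> exp (- sqrt N) / 2"
    by (rule exp_le_half)
  then show ?thesis unfolding exp_add using k N_pos by (simp add: exp_ln_power)
qed

lemma rho_q: "N powr (-1/64) * (N powr (-1/64) * N / (8 * real k * real t)) = N powr (31/32) / (8 * real k * real t)"
proof -
  have "N powr (-1/64) * (N powr (-1/64) * N powr 1) = N powr (31/32)"
    by (simp only: powr_add[symmetric]) simp
  then show ?thesis using N_pos by simp
qed

text \<open>Half of the exponent pays for the choice of one set, as \<open>M * ln (N + 1)\<close> is
  at most \<open>\<rho> * q / 8\<close>.\<close>

lemma union_over_sets: "(N + 1) ^ M * exp (- (N powr (31/32) / (8 * real k * real t)) / 4)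
    \<le> exp (- (N powr (31/32) / (8 * real k * real t)) / 8)"
proof -
  have "320 * sqrt N * ln (N + 1) \<le> N powr (17/32)" using N by (simp add: large_def)
  also have "\<dots> \<le> N powr (31/32)" using N_pos by (intro powr_mono) auto
  finally have "320 * sqrt N * ln (N + 1) \<le> N powr (31/32)" .
  moreover have "real k * real M * real t * ln (N + 1) \<le> 5 * sqrt N * ln (N + 1)"
    using kMt ln_k by (intro mult_right_mono) auto
  ultimately have "64 * (real k * real M * real t * ln (N + 1)) \<le> N powr (31/32)" by linarith
  then have "real M * ln (N + 1) \<le> N powr (31/32) / (8 * real k * real t) / 8"
    using k t by (simp add: field_simps)
  then have "exp (real M * ln (N + 1) + - (N powr (31/32) / (8 * real k * real t)) / 4)
    \<le> exp (- (N powr (31/32) / (8 * real k * real t)) / 8)" by simp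
  then show ?thesis unfolding exp_add using N_pos by (simp add: exp_ln_power)
qed

text \<open>\<open>m\<close> is the length of the greedy list; the factor 2 absorbs the
  rounding.\<close>

lemma steps_bounds:
  defines "m \<equiv> nat \<lfloor>N powr (5/16) / real M\<rfloor>"
  shows "real (m * M) \<le> N powr (5/16)" "N powr (5/16) / (2 * real M) \<le> real m"
proof -
  have y: "0 \<le> N powr (5/16) / real M" by simp
  then have "real m \<le> N powr (5/16) / real M" by (simp add: m_def)
  then show "real (m * M) \<le> N powr (5/16)" using M by (simp add: field_simps)
  have "real M \<le> N powr (1/4)" using M k by linarith
  then have "2 * real M \<le> N powr (1/16) * N powr (1/4)"
    using N by (intro mult_mono) (auto simp: large_def)
  also have "\<dots> = N powr (5/16)" using N_pos by (simp add: powr_add[symmetric])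
  finally have "2 \<le> N powr (5/16) / real M" using M by (simp add: field_simps)
  moreover have "real m > N powr (5/16) / real M - 1" using y unfolding m_def by linarith
  moreover have "N powr (5/16) / (2 * real M) = N powr (5/16) / real M / 2" by simp
  ultimately show "N powr (5/16) / (2 * real M) \<le> real m" by linarith
qed

text \<open>The \<open>m\<close> losses contribute an exponent of at least
  \<open>N powr (33/32) / (640 * k)\<close>, which beats the \<open>2 ^ b\<close> choices of
  \<open>U\<close> because \<open>b\<close> is at most \<open>2 * N / k\<close>.\<close>

lemma mostly_failure:
  assumes m: "N powr (5/16) / (2 * real M) \<le> real m" and b: "real b \<le> 2 * N / real k"
  shows "real k * (2 ^ b * exp (- (N powr (31/32) / (8 * real k * real t)) / 8) ^ m) \<le> exp (- sqrt N) / 2"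
proof -
  let ?w = "N powr (31/32) / (8 * real k * real t) / 8"
  have pos: "0 \<le> ?w" by simp
  have "N powr (33/32) * real k \<le> N powr (33/32) * N powr (1/4)"
    using k by (intro mult_left_mono) auto
  also have "\<dots> = N powr (5/16) * N powr (31/32)" using N_pos by (simp add: powr_add[symmetric])
  finally have 1: "N powr (33/32) * real k \<le> N powr (5/16) * N powr (31/32)" .
  have "real (M * t) \<le> real (5 * k)" using t(2) by (simp only: of_nat_le_iff)
  then have "N powr (33/32) * real k * (real M * real t)  \<le> (N powr (5/16) * N powr (31/32)) * (5 * real k)"
    using 1 by (intro mult_mono[OF 1]) auto
  then have "N powr (33/32) / 640 \<le> real k * (N powr (5/16) / (2 * real M) * ?w)"
    using k M t by (simp add: field_simps)
  also have "\<dots> \<le> real k * (real m * ?w)" using m pos by (intro mult_left_mono mult_right_mono) auto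
  finally have w: "N powr (33/32) / 640 \<le> real k * (real m * ?w)" .
  have "real k * (ln (real k) + real b * ln 2 + sqrt N + 1) \<le> N powr (33/32) / 640"
  proof -
    have "real k * ln (real k) \<le> N powr (1/4) * ln (N + 1)" using k ln_k by (intro mult_mono) auto
    moreover have "real k * (real b * ln 2) \<le> 2 * N"
    proof -
      have "real b * ln 2 \<le> real b * 1" using ln_2_less_1 by (intro mult_left_mono) auto
      then have "real k * (real b * ln 2) \<le> real k * (2 * N / real k)" using b by (intro mult_left_mono) auto
      then show ?thesis using k by simp
    qed
    moreover have "real k * sqrt N \<le> N powr (3/4)"
    proof -
      have "real k * sqrt N \<le> N powr (1/4) * N powr (1/2)"
        using k N_pos by (intro mult_mono) (auto simp: powr_half_sqrt)
      then show ?thesis by (simp add: powr_add[symmetric])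
    qed
    moreover have "N powr (1/4) * ln (N + 1) + 2 * N + N powr (3/4) + N powr (1/4) \<le> N powr (33/32) / 640"
      using N by (simp add: large_def)
    ultimately show ?thesis using k by (simp add: algebra_simps)
  qed
  also note w
  finally have "ln (real k) + real b * ln 2 + sqrt N + 1 \<le> real m * ?w"
    by (rule mult_left_le_imp_le) (use k in simp)
  then have "exp (ln (real k) + (real b * ln 2 + real m * (- ?w))) \<le> exp (- sqrt N) / 2"
    by (intro exp_le_half) simp
  then show ?thesis unfolding exp_add exp_of_nat_mult using k by simp
qed

text \<open>Each of the three error terms is at most \<open>N powr (- r / 8)\<close>, so 1 is at
  most \<open>3 * k * L\<^sup>2\<close> times this; solve for \<open>L\<close>.\<close>

lemma length_from_bound:
  fixes L r T s :: nat
  assumes "1 \<le> L" "6 \<le> r" "r \<le> T" "r \<le> M" and s: "real s \<le> N powr (5/16)"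
    and bound: "1 \<le> real L * (N powr (-7/16)) ^ T + real (L\<^sup>2 * k) * ((real s * N powr (-7/16)) ^ r +
      (N + 1) ^ M * exp (- (N powr (-7/16)) * (N powr (31/32) / (8 * real k * real t) / 4)))"
  shows "N powr (real r / 32) \<le> real L"
proof -
  let ?e = "N powr (- real r / 8)"
  have "(N powr (-7/16)) ^ T \<le> ?e"
  proof -
    have "(N powr (-7/16)) ^ T = N powr (real T * (-7/16))"
      using N_pos by (simp add: powr_powr powr_realpow[symmetric] mult.commute)
    also have "\<dots> \<le> ?e" using N_pos assms(3) by (intro powr_mono) auto
    finally show ?thesis .
  qed
  then have 1: "real L * (N powr (-7/16)) ^ T \<le> real (L\<^sup>2 * k) * ?e"
  proof -
    have "L * 1 \<le> L * (L * k)" using assms(1) k by (intro mult_left_mono) auto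
    then have "real L \<le> real (L\<^sup>2 * k)" by (simp only: of_nat_le_iff) (simp add: power2_eq_square)
    then show ?thesis using \<open>(N powr (-7/16)) ^ T \<le> ?e\<close> by (intro mult_mono) auto
  qed
  have 2: "(real s * N powr (-7/16)) ^ r \<le> ?e"
  proof -
    have "real s * N powr (-7/16) \<le> N powr (5/16) * N powr (-7/16)" using s by (intro mult_right_mono) auto
    also have "\<dots> = N powr (-1/8)" using N_pos by (simp add: powr_add[symmetric])
    finally have "(real s * N powr (-7/16)) ^ r \<le> (N powr (-1/8)) ^ r" by (intro power_mono) auto
    also have "\<dots> = ?e" using N_pos by (simp add: powr_powr powr_realpow[symmetric])
    finally show ?thesis .
  qed
  have 3: "(N + 1) ^ M * exp (- (N powr (-7/16)) * (N powr (31/32) / (8 * real k * real t) / 4)) \<le> ?e"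
  proof -
    have "N powr (-7/16) * N powr (31/32) = N powr (17/32)" using N_pos by (simp add: powr_add[symmetric])
    then have eq: "- (N powr (-7/16)) * (N powr (31/32) / (8 * real k * real t) / 4) =
        - (N powr (17/32) / (32 * real k * real t))" by (simp add: field_simps)
    have "320 * sqrt N * ln (N + 1) \<le> N powr (17/32)" using N by (simp add: large_def)
    moreover have "real k * real M * real t * ln (N + 1) \<le> 5 * sqrt N * ln (N + 1)"
      using kMt ln_k by (intro mult_right_mono) auto
    ultimately have "64 * (real k * real M * real t * ln (N + 1)) \<le> N powr (17/32)" by linarith
    \<comment> \<open>One copy of \<open>M * ln (N + 1)\<close> cancels \<open>(N + 1) ^ M\<close>,
      the other yields \<open>N powr (- r / 8)\<close>.\<close>
    then have "2 * (real M * ln (N + 1)) \<le> N powr (17/32) / (32 * real k * real t)"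
      using k t by (simp add: field_simps)
    moreover have "real r / 8 * ln N \<le> real M * ln (N + 1)"
      using assms(4) N_pos by (intro mult_mono) auto
    ultimately have "exp (real M * ln (N + 1) + - (N powr (17/32) / (32 * real k * real t)))
        \<le> exp (- real r / 8 * ln N)" by simp
    then show ?thesis unfolding eq exp_add using N_pos by (simp add: exp_ln_power powr_def)
  qed
  have "1 \<le> real (L\<^sup>2 * k) * ?e + real (L\<^sup>2 * k) * (?e + ?e)"
  proof -
    note bound
    also have "real L * (N powr (-7/16)) ^ T + real (L\<^sup>2 * k) * ((real s * N powr (-7/16)) ^ r +
      (N + 1) ^ M * exp (- (N powr (-7/16)) * (N powr (31/32) / (8 * real k * real t) / 4)))
      \<le> real (L\<^sup>2 * k) * ?e + real (L\<^sup>2 * k) * (?e + ?e)"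
      using 1 2 3 by (intro add_mono mult_left_mono) auto
    finally show ?thesis .
  qed
  also have "\<dots> = 3 * (real k * ((real L)\<^sup>2 * ?e))" by (simp add: algebra_simps)
  also have "\<dots> \<le> N powr (1/8) * (N powr (1/4) * ((real L)\<^sup>2 * ?e))"
    using N k by (intro mult_mono) (auto simp: large_def)
  also have "\<dots> = (real L)\<^sup>2 * N powr (1/8 + 1/4 + - real r / 8)"
    by (simp only: powr_add mult_ac)
  \<comment> \<open>\<open>6 \<le> r\<close> is what makes \<open>3/8 \<le> r / 16\<close>.\<close>
  also have "\<dots> \<le> (real L)\<^sup>2 * N powr (- real r / 16)"
    using N_pos assms(2) by (intro mult_left_mono powr_mono) auto
  finally have "1 \<le> (real L)\<^sup>2 * N powr (- real r / 16)" .
  then have "1 * N powr (real r / 16) \<le> ((real L)\<^sup>2 * N powr (- real r / 16)) * N powr (real r / 16)"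
    by (intro mult_right_mono) auto
  also have "\<dots> = (real L)\<^sup>2" using N_pos by (simp add: mult.assoc powr_add[symmetric])
  finally have "(N powr (real r / 32))\<^sup>2 \<le> (real L)\<^sup>2"
    using N_pos by (simp add: power2_eq_square powr_add[symmetric])
  then show ?thesis by (rule power2_le_imp_le) simp
qed

end

section \<open>The lower bound\<close>

context
  fixes V :: "'a set" and k :: nat and W :: "nat \<Rightarrow> 'a set" and n :: nat
  assumes V: "finite V" "card V = n" "balanced_partition V k W"
    and k: "k > 0" "real k \<le> real n powr (1/4)" and N: "large (real n)"
begin

lemma block_card_bounds:
  assumes "i \<in> {1..k}"
  shows "real n / (2 * real k) \<le> real (card (W i))" "real (card (W i)) \<le> 2 * real n / real k"
proof -
  have n1: "real n \<ge> 1" using N by (simp add: large_def)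
  have "2 \<le> real n powr (1/16)" using N by (simp add: large_def)
  also have "\<dots> \<le> real n powr (3/4)" using n1 by (intro powr_mono) auto
  finally have "real k * 2 \<le> real n powr (1/4) * real n powr (3/4)" using k by (intro mult_mono) auto
  also have "\<dots> = real n" using n1 by (simp add: powr_add[symmetric])
  finally have k2: "real k * 2 \<le> real n" .
  have "n \<le> k * (card (W i) + 1)" "k * card (W i) \<le> n + k"
    using balanced_partition_card[OF V(3,1) assms] V(2) by auto
  then have "real n \<le> real (k * (card (W i) + 1))" "real (k * card (W i)) \<le> real (n + k)"
    by (simp_all only: of_nat_le_iff)
  then have "real n \<le> real k * real (card (W i)) + real k" "real k * real (card (W i)) \<le> real n + real k"
    by (simp_all add: algebra_simps)
  with k2 have "real n \<le> 2 * (real k * real (card (W i)))" "real k * real (card (W i)) \<le> 2 * real n"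
    by linarith+
  then show "real n / (2 * real k) \<le> real (card (W i))" "real (card (W i)) \<le> 2 * real n / real k"
    using k(1) by (simp_all add: field_simps)
qed

lemma clique_refutationI:
  assumes "resolution_refutation (Clique_block V E k W) \<pi>" "regular \<pi>"
  shows "clique_refutation V E k W \<pi>"
  using assms V by unfold_locales (auto simp: balanced_partition_def)

text \<open>Some block is queried completely, and it has at least \<open>n / (2 * k)\<close>
  vertices; this holds in every graph.\<close>

lemma length_ge_sqrt:
  assumes "resolution_refutation (Clique_block V E k W) \<pi>" "regular \<pi>"
  shows "real n powr (1/2) \<le> real (length \<pi>)"
proof -
  interpret clique_refutation V E k W \<pi> using clique_refutationI[OF assms] .
  obtain i where i: "i \<in> {1..k}" "card (W i) \<le> length \<pi>" using block_card_le_length by blast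
  have n1: "real n \<ge> 1" using N by (simp add: large_def)
  have "2 \<le> real n powr (1/16)" using N by (simp add: large_def)
  also have "\<dots> \<le> real n powr (1/4)" using n1 by (intro powr_mono) auto
  finally have "2 * real k \<le> real n powr (1/4) * real n powr (1/4)" using k by (intro mult_mono) auto
  also have "\<dots> = real n powr (1/2)" by (simp add: powr_add[symmetric])
  finally have "real n powr (1/2) * (2 * real k) \<le> real n powr (1/2) * real n powr (1/2)"
    by (intro mult_left_mono) auto
  also have "\<dots> = real n" using n1 by (simp add: powr_add[symmetric])
  finally have "real n powr (1/2) \<le> real n / (2 * real k)" using k(1) by (simp add: field_simps)
  then show ?thesis using block_card_bounds(1)[OF i(1)] i(2) by linarith
qed

text \<open>Outside two bad events for the graph, \<open>length_bound\<close> and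
  \<open>length_from_bound\<close> give \<open>n powr (r / 32)\<close>; the constant is
  \<open>83886080 = 32 * 2621440\<close>.\<close>

lemma prob_long_refutations:
  fixes \<xi> :: real
  assumes \<xi>: "\<xi> > 1" and big: "real k / \<xi>\<^sup>2 > 41943040"
  shows "measure_pmf.prob (erdos_renyi V (real n powr (- 2 * \<xi> / (real k - 1))))
      {E. \<forall>\<pi>. resolution_refutation (Clique_block V E k W) \<pi> \<and> regular \<pi> \<longrightarrow>
        real (length \<pi>) \<ge> real n powr (real k / \<xi>\<^sup>2 / 83886080)}
    \<ge> 1 - exp (- sqrt (real n))"
proof -
  obtain M l r :: nat where par: "2 * \<xi> * real M / (real k - 1) \<le> 1 / 64" "1 \<le> M" "M \<le> k"
    "k \<le> l * (M div 2)" "Suc l * r \<le> M" "M * Suc l \<le> 5 * k" "r \<le> M div 2" "6 \<le> r"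
    "real k / \<xi>\<^sup>2 / 2621440 \<le> real r"
    using parameters_exist[OF \<xi> big] by metis
  let ?N = "real n"
  have n1: "?N \<ge> 1" using N by (simp add: large_def)
  define p where "p = ?N powr (- 2 * \<xi> / (real k - 1))"
  define \<rho> where "\<rho> = ?N powr (-1/64)"
  \<comment> \<open>Makes \<open>Suc l * q\<close> a quarter of \<open>\<rho> * n / (2 * k)\<close>,
    a lower bound for the expected number of common neighbours in a block.\<close>
  define q where "q = \<rho> * ?N / (8 * real k * real (Suc l))"
  \<comment> \<open>The quarter leaves \<open>q' - \<rho> * q / 2 = - \<rho> * q / 4\<close> in the
    exponent.\<close>
  define q' where "q' = \<rho> * q / 4"
  define m where "m = nat \<lfloor>?N powr (5/16) / real M\<rfloor>"
  \<comment> \<open>Two demands meet here: \<open>m * M * \<delta>\<close> must be a negative power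
    of \<open>n\<close>, while \<open>\<delta> * q'\<close> must exceed
    \<open>M * ln (n + 1)\<close>.\<close>
  define \<delta> where "\<delta> = ?N powr (-7/16)"
  let ?P = "erdos_renyi V p"
  have k1: "1 \<le> k" using k(1) by simp
  have t1: "1 \<le> Suc l" by simp
  have rq: "\<rho> * q = ?N powr (31/32) / (8 * real k * real (Suc l))"
    unfolding \<rho>_def q_def by (rule rho_q[OF N k1 k(2) par(2,3) t1 par(6)])
  have \<rho>: "0 \<le> \<rho>" by (simp add: \<rho>_def)
  have "real k > 1" using par(2,3,8,7) by linarith
  then have "- 2 * \<xi> / (real k - 1) \<le> 0" using \<xi> by (intro divide_nonpos_pos) auto
  then have p: "0 \<le> p" "p \<le> 1" using n1 powr_mono[of _ 0 ?N] by (auto simp: p_def)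
  have \<rho>p: "\<rho> \<le> p ^ M"
  proof -
    have "\<rho> \<le> ?N powr (- (2 * \<xi> * real M / (real k - 1)))"
      unfolding \<rho>_def using n1 par(1) by (intro powr_mono) auto
    also have "\<dots> = p ^ M"
      using n1 by (simp add: p_def powr_powr powr_realpow[symmetric] mult.assoc)
    finally show ?thesis .
  qed
  have q0: "q > 0" using n1 k(1) by (auto simp: q_def \<rho>_def)
  have tq: "real (Suc l) * q = \<rho> * ?N / (8 * real k)" by (simp add: q_def del: of_nat_Suc)
  have WV: "W i \<subseteq> V" if "i \<in> {1..k}" for i using V(3) that by (auto simp: balanced_partition_def)
  define A where "A = (\<lambda>i. {E. \<not> nbr_dense E (V - W i) (W i) M (real (Suc l) * q)})"
  define B where "B = (\<lambda>i. {E. \<exists>U\<subseteq>W i. nbr_dense E (V - W i) U r q \<and>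
    \<not> mostly_dense E (V - W i) U (m * M) M r q'})"
  have PA: "measure_pmf.prob ?P (A i) \<le> (?N + 1) ^ M * exp (- (\<rho> * ?N / (8 * real k)))"
    if i: "i \<in> {1..k}" for i
  proof -
    have "measure_pmf.prob ?P (A i) \<le> real ((card V + 1) ^ M) * exp (real (Suc l) * q - \<rho> * card (W i) / 2)"
      unfolding A_def using i by (intro prob_block_not_dense p V WV \<rho> \<rho>p)
    also have "\<dots> \<le> real ((card V + 1) ^ M) * exp (- (\<rho> * ?N / (8 * real k)))"
    proof -
      have "\<rho> * (?N / (2 * real k)) \<le> \<rho> * real (card (W i))"
        using block_card_bounds(1)[OF i] \<rho> by (intro mult_left_mono)
      moreover have "\<rho> * (?N / (2 * real k)) = 4 * (\<rho> * ?N / (8 * real k))" by simp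
      ultimately have "real (Suc l) * q - \<rho> * card (W i) / 2 \<le> - (\<rho> * ?N / (8 * real k))"
        unfolding tq by linarith
      then show ?thesis by (intro mult_left_mono) auto
    qed
    finally show ?thesis by (simp add: V(2) add.commute)
  qed
  \<comment> \<open>A common bound on the block sizes makes the failure bound the same for all
    blocks.\<close>
  define b where "b = Max ((\<lambda>i. card (W i)) ` {1..k})"
  have bge: "card (W i) \<le> b" if "i \<in> {1..k}" for i using that by (simp add: b_def)
  have "b \<in> (\<lambda>i. card (W i)) ` {1..k}" unfolding b_def using k(1) by (intro Max_in) auto
  then have bb: "real b \<le> 2 * ?N / real k" using block_card_bounds(2) by auto
  have PB: "measure_pmf.prob ?P (B i) \<le> 2 ^ b * exp (- (?N powr (31/32) / (8 * real k * real (Suc l))) / 8) ^ m"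
    if i: "i \<in> {1..k}" for i
  proof -
    have "measure_pmf.prob ?P (B i) \<le> 2 ^ card (W i) * (real ((card V + 1) ^ M) * exp (q' - \<rho> * q / 2)) ^ m"
      unfolding B_def using i q0 by (intro prob_dense_not_mostly_dense p V WV \<rho> \<rho>p) auto
    also have "real ((card V + 1) ^ M) * exp (q' - \<rho> * q / 2) =
        (?N + 1) ^ M * exp (- (?N powr (31/32) / (8 * real k * real (Suc l))) / 4)"
      unfolding rq[symmetric] q'_def by (simp add: V(2) add.commute)
    also have "2 ^ card (W i) * \<dots> ^ m \<le> 2 ^ b * exp (- (?N powr (31/32) / (8 * real k * real (Suc l))) / 8) ^ m"
      using bge[OF i] n1 by (intro mult_mono power_mono power_increasing
          union_over_sets[OF N k1 k(2) par(2,3) t1 par(6)]) auto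
    finally show ?thesis .
  qed
  note mb = steps_bounds[OF N k1 k(2) par(2,3) t1 par(6), folded m_def]
  let ?bad = "(\<Union>i\<in>{1..k}. A i) \<union> (\<Union>i\<in>{1..k}. B i)"
  have "measure_pmf.prob ?P ?bad \<le>
      measure_pmf.prob ?P (\<Union>i\<in>{1..k}. A i) + measure_pmf.prob ?P (\<Union>i\<in>{1..k}. B i)"
    by (intro measure_Un_le) auto
  also have "measure_pmf.prob ?P (\<Union>i\<in>{1..k}. A i) \<le> (\<Sum>i\<in>{1..k}. measure_pmf.prob ?P (A i))"
    by (intro measure_UNION_le) auto
  also have "\<dots> \<le> (\<Sum>i\<in>{1..k}. (?N + 1) ^ M * exp (- (\<rho> * ?N / (8 * real k))))"
    by (intro sum_mono PA)
  also have "\<dots> = real k * ((?N + 1) ^ M * exp (- (\<rho> * ?N / (8 * real k))))" by simp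
  also have "\<dots> \<le> exp (- sqrt ?N) / 2"
    unfolding \<rho>_def by (rule blocks_failure[OF N k1 k(2) par(2,3) t1 par(6)])
  also have "measure_pmf.prob ?P (\<Union>i\<in>{1..k}. B i) \<le> (\<Sum>i\<in>{1..k}. measure_pmf.prob ?P (B i))"
    by (intro measure_UNION_le) auto
  also have "\<dots> \<le> (\<Sum>i\<in>{1..k}. 2 ^ b * exp (- (?N powr (31/32) / (8 * real k * real (Suc l))) / 8) ^ m)"
    by (intro sum_mono PB)
  also have "\<dots> = real k * (2 ^ b * exp (- (?N powr (31/32) / (8 * real k * real (Suc l))) / 8) ^ m)"
    by simp
  also have "\<dots> \<le> exp (- sqrt ?N) / 2"
    by (rule mostly_failure[OF N k1 k(2) par(2,3) t1 par(6) mb(2) bb])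
  finally have bad: "measure_pmf.prob ?P ?bad \<le> exp (- sqrt ?N)" by simp
  have good: "- ?bad \<subseteq> {E. \<forall>\<pi>. resolution_refutation (Clique_block V E k W) \<pi> \<and> regular \<pi> \<longrightarrow>
      real (length \<pi>) \<ge> ?N powr (real k / \<xi>\<^sup>2 / 83886080)}"
  proof (intro subsetI CollectI allI impI, elim conjE)
    fix E \<pi>
    assume E: "E \<in> - ?bad" and \<pi>: "resolution_refutation (Clique_block V E k W) \<pi>" "regular \<pi>"
    interpret clique_refutation V E k W \<pi> using clique_refutationI[OF \<pi>] .
    have "1 \<le> real (length \<pi>) * \<delta> ^ (M div 2) + real ((length \<pi>)\<^sup>2 * k) *
      ((real (m * M) * \<delta>) ^ r + real ((card V + 1) ^ M) * exp (- \<delta> * q'))"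
    proof (rule length_bound)
      show "0 \<le> \<delta>" "\<delta> \<le> 1" using n1 powr_mono[of "-7/16" 0 ?N] by (auto simp: \<delta>_def)
      show "real (Suc l) * q \<le> real (card (common_nbrs E (W i) R))"
        if "i \<in> {1..k}" "R \<subseteq> V - W i" "card R \<le> Suc l * r" for i R
      proof -
        have "nbr_dense E (V - W i) (W i) M (real (Suc l) * q)" using E that(1) unfolding A_def by blast
        moreover have "card R \<le> M" using that(3) par(5) by linarith
        ultimately show ?thesis using that(2) unfolding nbr_dense_def by blast
      qed
      show "\<exists>S\<subseteq>V. card S \<le> m * M \<and> (\<forall>R. R \<subseteq> V - W i \<and> card R \<le> M \<and>
          real (card (common_nbrs E U R)) < q' \<longrightarrow> r \<le> card (R \<inter> S))"
        if "i \<in> {1..k}" "U \<subseteq> W i" "nbr_dense E (V - W i) U r q" for i U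
      proof -
        have "mostly_dense E (V - W i) U (m * M) M r q'" using E that unfolding B_def by blast
        then show ?thesis unfolding mostly_dense_def by (meson Diff_subset subset_trans)
      qed
    qed (use par q0 in auto)
    then have bound: "1 \<le> real (length \<pi>) * (?N powr (-7/16)) ^ (M div 2) + real ((length \<pi>)\<^sup>2 * k) *
      ((real (m * M) * ?N powr (-7/16)) ^ r + (?N + 1) ^ M *
        exp (- (?N powr (-7/16)) * (?N powr (31/32) / (8 * real k * real (Suc l)) / 4)))"
      unfolding \<delta>_def q'_def rq by (simp add: V(2) add.commute)
    have "?N powr (real r / 32) \<le> real (length \<pi>)"
      by (rule length_from_bound[OF N k1 k(2) par(2,3) t1 par(6) _ par(8,7) _ mb(1) bound])
        (use root_less par(7) in auto)
    moreover have "?N powr (real k / \<xi>\<^sup>2 / 83886080) \<le> ?N powr (real r / 32)"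
      using n1 par(9) by (intro powr_mono) auto
    ultimately show "?N powr (real k / \<xi>\<^sup>2 / 83886080) \<le> real (length \<pi>)" by linarith
  qed
  have "1 - exp (- sqrt ?N) \<le> 1 - measure_pmf.prob ?P ?bad" using bad by simp
  also have "\<dots> = measure_pmf.prob ?P (- ?bad)"
    by (subst measure_pmf.prob_compl[symmetric]) (auto simp: Compl_eq_Diff_UNIV)
  also have "\<dots> \<le> measure_pmf.prob ?P {E. \<forall>\<pi>. resolution_refutation (Clique_block V E k W) \<pi> \<and> regular \<pi> \<longrightarrow>
      real (length \<pi>) \<ge> ?N powr (real k / \<xi>\<^sup>2 / 83886080)}"
    using good by (intro measure_pmf.finite_measure_mono) auto
  finally show ?thesis by (simp only: p_def)
qed

end

theorem theorem4p1:
  fixes \<epsilon> :: real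
  assumes "\<epsilon> > 0"
  shows "\<exists>c::real. c > 0 \<and>
    (\<forall>\<^sub>F n::nat in sequentially.
      \<forall>(k::nat) (\<xi>::real) (V::nat set) (W::nat \<Rightarrow> nat set).
        k > 0 \<and> real k \<le> real n powr (1/4 - \<epsilon>) \<and> \<xi> > 1 \<and>
        finite V \<and> card V = n \<and> balanced_partition V k W \<longrightarrow>
        measure_pmf.prob (erdos_renyi V (real n powr (- 2 * \<xi> / (real k - 1))))
          {E. \<forall>\<pi>. resolution_refutation (Clique_block V E k W) \<pi> \<and> regular \<pi> \<longrightarrow>
                  real (length \<pi>) \<ge> real n powr (c * real k / \<xi>\<^sup>2)}
        \<ge> 1 - exp (- sqrt (real n)))"
proof (intro exI[of _ "1 / 83886080"] conjI)
  let ?Q = "\<lambda>n k \<xi> V W. 1 - exp (- sqrt (real n)) \<le>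
    measure_pmf.prob (erdos_renyi V (real n powr (- 2 * \<xi> / (real k - 1))))
      {E. \<forall>\<pi>. resolution_refutation (Clique_block V E k W) \<pi> \<and> regular \<pi> \<longrightarrow>
        real (length \<pi>) \<ge> real n powr (1 / 83886080 * real k / \<xi>\<^sup>2)}"
  have "?Q n k \<xi> V W" if N: "large (real n)" and k: "k > 0" "real k \<le> real n powr (1/4 - \<epsilon>)"
    and \<xi>: "\<xi> > 1" and V: "finite V" "card V = n" "balanced_partition V k W"
    for n k :: nat and \<xi> :: real and V :: "nat set" and W
  proof -
    have n1: "real n \<ge> 1" using N by (simp add: large_def)
    have "real n powr (1/4 - \<epsilon>) \<le> real n powr (1/4)" using n1 assms by (intro powr_mono) auto
    then have k4: "real k \<le> real n powr (1/4)" using k(2) by linarith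
    show ?thesis
    proof (cases "real k / \<xi>\<^sup>2 > 41943040")
      case True
      then show ?thesis using prob_long_refutations[OF V k(1) k4 N \<xi>] by (simp add: mult.commute)
    next
      case False
      \<comment> \<open>The exponent is at most \<open>41943040 / 83886080 = 1/2\<close>, so the
        bound for every graph suffices. The case \<open>k = 1\<close>, where \<open>k - 1\<close>
        vanishes, falls here.\<close>
      then have "real n powr (1 / 83886080 * real k / \<xi>\<^sup>2) \<le> real n powr (1/2)"
        using n1 by (intro powr_mono) auto
      then have "{E. \<forall>\<pi>. resolution_refutation (Clique_block V E k W) \<pi> \<and> regular \<pi> \<longrightarrow>
        real (length \<pi>) \<ge> real n powr (1 / 83886080 * real k / \<xi>\<^sup>2)} = UNIV"
        using length_ge_sqrt[OF V k(1) k4 N] by (auto intro: order_trans)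
      then show ?thesis by simp
    qed
  qed
  then show "\<forall>\<^sub>F n::nat in sequentially. \<forall>(k::nat) (\<xi>::real) (V::nat set) (W::nat \<Rightarrow> nat set).
      k > 0 \<and> real k \<le> real n powr (1/4 - \<epsilon>) \<and> \<xi> > 1 \<and>
      finite V \<and> card V = n \<and> balanced_partition V k W \<longrightarrow> ?Q n k \<xi> V W"
    by (intro eventually_mono[OF eventually_large]) blast
qed simp

end
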